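(* Let $\Omega=(\Omega_n)_{n=0}^\infty\subset[0,\infty)$ with $\Omega_0\neq0$, and let $W_n=\sum_{k=0}^n\Omega_k$, $n=0,1,2,\dots$ (i) If $0<p<1$, $d(\Omega,p)$ is normable if and only if $\Omega\in\ell^1$. (ii) $d(\Omega,1)$ is normable if and only if there is $C<\infty$ such that $$\frac{W_n}{n+1}\le C\,\frac{W_m}{m+1},\qquad 0<m<n.$$ (iii) If $1<p<\infty$, $d(\Omega,p)$ is normable if and only if there is $C<\infty$ such that $$\sum_{k=0}^n\frac1{W_k^{1/p}}\le C\,\frac{n+1}{W_n^{1/p}},\qquad n=0,1,2,\dots$$ That is, if $p<1$, $d(\Omega,p)$ is not normable except in the trivial case $\Omega\in\ell^1$, and then $d(\Omega,p)=\ell^\infty$.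
   Context: For a complex sequence $f=(f(n))_{n\ge0}$, $f^*$ is its nonincreasing rearrangement, $f^*(n)=\inf\{s>0:\#\{k:|f(k)|>s\}\le n\}$. For $0<p<\infty$, $\|f\|_{d(\Omega,p)}=\big(\sum_{n=0}^\infty f^*(n)^p\,\Omega_n\big)^{1/p}$ and $d(\Omega,p)=\{f:\|f\|_{d(\Omega,p)}<\infty\}$. The space $d(\Omega,p)$ is normable if there is a norm on $d(\Omega,p)$ equivalent to the functional $\|\cdot\|_{d(\Omega,p)}$. *)

theory Defs
  imports "HOL-Analysis.Analysis"
begin

text \<open>
  The infimum is taken in the extended half-line, so an unbounded sequence has
  rearrangement constantly \<^term>\<open>\<infinity>\<close>. The finiteness conjunct is needed because \<^const>\<open>card\<close>
  sends infinite sets to 0.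
\<close>

definition rearrangement :: "(nat \<Rightarrow> complex) \<Rightarrow> nat \<Rightarrow> ennreal" where
  "rearrangement f n =
     Inf {ennreal s | s. s > 0 \<and> finite {k. cmod (f k) > s} \<and> card {k. cmod (f k) > s} \<le> n}"

text \<open>Only used with a positive exponent, where \<^term>\<open>\<infinity>\<close> to the power \<open>p\<close> is \<^term>\<open>\<infinity>\<close>.\<close>

definition ennreal_powr :: "ennreal \<Rightarrow> real \<Rightarrow> ennreal" where
  "ennreal_powr x p = (if x = \<infinity> then \<infinity> else ennreal (enn2real x powr p))"

definition lorentz_norm :: "(nat \<Rightarrow> real) \<Rightarrow> real \<Rightarrow> (nat \<Rightarrow> complex) \<Rightarrow> ennreal" where
  "lorentz_norm \<Omega> p f =
     ennreal_powr (\<Sum>n. ennreal_powr (rearrangement f n) p * ennreal (\<Omega> n)) (1 / p)"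

definition lorentz_space :: "(nat \<Rightarrow> real) \<Rightarrow> real \<Rightarrow> (nat \<Rightarrow> complex) set" where
  "lorentz_space \<Omega> p = {f. lorentz_norm \<Omega> p f < \<infinity>}"

definition linear_sequence_space :: "(nat \<Rightarrow> complex) set \<Rightarrow> bool" where
  "linear_sequence_space V \<longleftrightarrow>
     (\<lambda>n. 0) \<in> V \<and>
     (\<forall>f\<in>V. \<forall>g\<in>V. (\<lambda>n. f n + g n) \<in> V) \<and>
     (\<forall>c. \<forall>f\<in>V. (\<lambda>n. c * f n) \<in> V)"

definition norm_on :: "(nat \<Rightarrow> complex) set \<Rightarrow> ((nat \<Rightarrow> complex) \<Rightarrow> real) \<Rightarrow> bool" where
  "norm_on V N \<longleftrightarrow>
     (\<forall>f\<in>V. 0 \<le> N f) \<and>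
     (\<forall>f\<in>V. N f = 0 \<longleftrightarrow> f = (\<lambda>n. 0)) \<and>
     (\<forall>c. \<forall>f\<in>V. N (\<lambda>n. c * f n) = cmod c * N f) \<and>
     (\<forall>f\<in>V. \<forall>g\<in>V. N (\<lambda>n. f n + g n) \<le> N f + N g)"

text \<open>
  For a general weight \<open>d(\<Omega>,p)\<close> need not be closed under addition. A norm only makes sense
  on a vector space, so being one is part of normability.
\<close>

definition lorentz_normable :: "(nat \<Rightarrow> real) \<Rightarrow> real \<Rightarrow> bool" where
  "lorentz_normable \<Omega> p \<longleftrightarrow>
     linear_sequence_space (lorentz_space \<Omega> p) \<and>
     (\<exists>N. norm_on (lorentz_space \<Omega> p) N \<and>
        (\<exists>a>0. \<exists>b>0. \<forall>f\<in>lorentz_space \<Omega> p.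
           ennreal a * lorentz_norm \<Omega> p f \<le> ennreal (N f) \<and>
           ennreal (N f) \<le> ennreal b * lorentz_norm \<Omega> p f))"

definition partial_weight :: "(nat \<Rightarrow> real) \<Rightarrow> nat \<Rightarrow> real" where
  "partial_weight \<Omega> n = (\<Sum>k\<le>n. \<Omega> k)"

definition little_l1 :: "(nat \<Rightarrow> real) set" where
  "little_l1 = {x. summable (\<lambda>n. \<bar>x n\<bar>)}"

definition little_linf :: "(nat \<Rightarrow> complex) set" where
  "little_linf = {f. bounded (range f)}"

end

theory Submission
  imports Defs
begin

text \<open>
  Write \<open>W n = \<Omega> 0 + \<dots> + \<Omega> (n - 1)\<close> and \<open>u n = n / W n powr (1 / p)\<close>. A norm equivalent to the Lorentz
  functional exists as soon as the functional is equivalent to a subadditive one. For \<open>p < 1\<close> and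
  summable \<open>\<Omega>\<close> that is the supremum; for \<open>p = 1\<close> one replaces \<open>W\<close> by an equivalent concave sequence, and
  for \<open>p > 1\<close> one replaces the rearrangement by its averages, using a Hardy inequality that holds once
  \<open>u (K * n) \<ge> 4 * u n\<close> for some \<open>K\<close>.

  Conversely, a norm gives a triangle inequality with a constant for arbitrarily many summands.
  Applied to the cyclic shifts of a decreasing \<open>x\<close> supported on \<open>{..<N}\<close> it bounds the mean of \<open>x\<close> times
  \<open>W N powr (1 / p)\<close> by the Lorentz functional of \<open>x\<close>. Indicators then give the condition for \<open>p = 1\<close>, and
  sums of dyadic indicators give \<open>u (K * n) \<ge> 2 * C * u n\<close> for \<open>p > 1\<close>, hence the condition on sums. For
  \<open>p < 1\<close> normalized indicators along a fast increasing sequence contradict the inequality unless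
  \<open>W\<close> is bounded.
\<close>

subsection \<open>Inequalities for finite sums\<close>

text \<open>Summation by parts. The induction needs the stronger bound by \<open>x n\<close> times
  the last partial sum of \<open>d\<close>: this only shrinks when \<open>x n\<close> is replaced by
  \<open>x (Suc n)\<close>, because the partial sum is nonnegative.\<close>

lemma sum_mult_antimono_nonneg:
  fixes x d :: "nat \<Rightarrow> real"
  assumes x: "antimono x" "\<And>n. 0 \<le> x n"
    and d: "\<And>n. 0 \<le> (\<Sum>k<n. d k)"
  shows "0 \<le> (\<Sum>k<n. x k * d k)"
proof -
  have "x n * (\<Sum>k<Suc n. d k) \<le> (\<Sum>k<Suc n. x k * d k)" for n
  proof (induction n)
    case (Suc n)
    have "x (Suc n) * (\<Sum>k<Suc n. d k) \<le> x n * (\<Sum>k<Suc n. d k)"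
      using x(1) by (intro mult_right_mono d) (auto simp: antimono_def)
    then show ?case
      using Suc by (simp add: algebra_simps)
  qed simp
  moreover have "0 \<le> x n * (\<Sum>k<Suc n. d k)" for n
    using x(2) d[of "Suc n"] by (metis mult_nonneg_nonneg)
  ultimately show ?thesis
    by (cases n) (auto intro: order_trans simp del: sum.lessThan_Suc)
qed

text \<open>Hardy's lemma. The decreasing factor is sometimes the weight, to get subadditivity, and
  sometimes the rearrangement, to compare two weights.\<close>

lemma sum_mult_antimono_mono:
  fixes x a b :: "nat \<Rightarrow> real"
  assumes "antimono x" "\<And>n. 0 \<le> x n"
    and "\<And>n. (\<Sum>k<n. a k) \<le> (\<Sum>k<n. b k)"
  shows "(\<Sum>k<n. x k * a k) \<le> (\<Sum>k<n. x k * b k)"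
  using sum_mult_antimono_nonneg[OF assms(1,2), of "\<lambda>k. b k - a k" n] assms(3)
  by (simp add: algebra_simps sum_subtractf)

text \<open>Convexity of \<open>z powr p\<close> on positive arguments settles the last case. If
  \<open>a\<close> or \<open>b\<close> vanishes, the claim reduces to \<open>s powr p <= s\<close>
  on the unit interval.\<close>

lemma powr_convex_combination:
  fixes a b t p :: real
  assumes p: "1 \<le> p" and ab: "0 \<le> a" "0 \<le> b" and t: "0 \<le> t" "t \<le> 1"
  shows "(t * a + (1 - t) * b) powr p \<le> t * a powr p + (1 - t) * b powr p"
proof -
  have le: "(s * c) powr p \<le> s * c powr p" if "0 \<le> s" "s \<le> 1" for s c :: real
  proof -
    have "s powr p \<le> s"
      using powr_le_one_le[of s p] p that by (cases "s = 0") auto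
    then show ?thesis
      by (simp add: powr_mult mult_right_mono)
  qed
  consider "a = 0" | "b = 0" | "0 < a" "0 < b"
    using ab by force
  then show ?thesis
  proof cases
    case 1
    then show ?thesis using le[of "1 - t" b] t by simp
  next
    case 2
    then show ?thesis using le[of t a] t by simp
  next
    case 3
    then show ?thesis
      using convex_onD[OF powr_convex[OF p], of "1 - t" a b] t by (simp add: algebra_simps)
  qed
qed

lemma sum_powr_root_mono:
  fixes x y w :: "nat \<Rightarrow> real"
  assumes "0 < p" "\<And>k. 0 \<le> w k" "\<And>k. 0 \<le> x k" "\<And>k. x k \<le> y k"
  shows "(\<Sum>k<n. x k powr p * w k) powr (1 / p) \<le> (\<Sum>k<n. y k powr p * w k) powr (1 / p)"
  using assms by (intro powr_mono2 sum_mono mult_right_mono sum_nonneg) auto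

lemma sum_powr_root_cmult:
  fixes x w :: "nat \<Rightarrow> real"
  assumes "0 < p" "0 \<le> c"
  shows "(\<Sum>k<n. (c * x k) powr p * w k) powr (1 / p)
    = c * (\<Sum>k<n. x k powr p * w k) powr (1 / p)"
proof -
  have "(\<Sum>k<n. (c * x k) powr p * w k) = c powr p * (\<Sum>k<n. x k powr p * w k)"
    by (simp add: powr_mult sum_distrib_left mult.assoc)
  then show ?thesis
    using assms by (simp add: powr_mult powr_powr)
qed

text \<open>After normalizing, \<open>x + y\<close> is \<open>A' + B'\<close> times a convex
  combination of \<open>x / A'\<close> and \<open>y / B'\<close> with weight
  \<open>t = A' / (A' + B')\<close>. Convexity of the power bounds its weighted sum
  termwise.\<close>

lemma Minkowski_sum_powr:
  fixes x y w :: "nat \<Rightarrow> real"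
  assumes p: "1 \<le> p" and w: "\<And>k. 0 \<le> w k" and x: "\<And>k. 0 \<le> x k" and y: "\<And>k. 0 \<le> y k"
  shows "(\<Sum>k<n. (x k + y k) powr p * w k) powr (1 / p)
    \<le> (\<Sum>k<n. x k powr p * w k) powr (1 / p) + (\<Sum>k<n. y k powr p * w k) powr (1 / p)"
proof -
  define S where "S z = (\<Sum>k<n. z k powr p * w k)" for z :: "nat \<Rightarrow> real"
  define A B where "A = S x powr (1 / p)" and "B = S y powr (1 / p)"
  have S0: "0 \<le> S z" for z
    unfolding S_def using w by (intro sum_nonneg) auto
  have AB: "A powr p = S x" "B powr p = S y" "0 \<le> A" "0 \<le> B"
    using p S0 by (simp_all add: A_def B_def powr_powr)
  \<comment> \<open>The positive bounds \<open>A'\<close> and \<open>B'\<close> replace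
    \<open>A\<close> and \<open>B\<close>, which may be 0 and could not be divided by; an
    arbitrarily small enlargement suffices at the end.\<close>
  have main: "S (\<lambda>k. x k + y k) powr (1 / p) \<le> A' + B'"
    if A': "A \<le> A'" "0 < A'" and B': "B \<le> B'" "0 < B'" for A' B'
  proof -
    define t where "t = A' / (A' + B')"
    have t: "0 \<le> t" "t \<le> 1" "1 - t = B' / (A' + B')"
      using A' B' by (auto simp: t_def field_simps)
    have "S (\<lambda>k. x k + y k) \<le> (\<Sum>k<n. (A' + B') powr p *
        (t * ((x k / A') powr p * w k) + (1 - t) * ((y k / B') powr p * w k)))"
      unfolding S_def
    proof (intro sum_mono)
      fix k
      have eq: "x k + y k = (A' + B') * (t * (x k / A') + (1 - t) * (y k / B'))"
        using A' B' unfolding t(3) unfolding t_def by (simp add: distrib_left)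
      have "(x k + y k) powr p
          = (A' + B') powr p * (t * (x k / A') + (1 - t) * (y k / B')) powr p"
        by (subst eq) (rule powr_mult)
      also have "\<dots> \<le> (A' + B') powr p * (t * (x k / A') powr p + (1 - t) * (y k / B') powr p)"
        using t A' B' x y p by (intro mult_left_mono powr_convex_combination) auto
      finally have "(x k + y k) powr p * w k
        \<le> (A' + B') powr p * (t * (x k / A') powr p + (1 - t) * (y k / B') powr p) * w k"
        using w by (rule mult_right_mono)
      then show "(x k + y k) powr p * w k \<le> (A' + B') powr p *
          (t * ((x k / A') powr p * w k) + (1 - t) * ((y k / B') powr p * w k))"
        by (simp add: algebra_simps)
    qed
    also have "\<dots> = (A' + B') powr p * (t * (S x / A' powr p) + (1 - t) * (S y / B' powr p))"
      by (simp add: S_def powr_divide sum_distrib_left sum_divide_distrib sum.distrib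
          distrib_left)
    also have "\<dots> \<le> (A' + B') powr p * (t * 1 + (1 - t) * 1)"
    proof -
      have "S x \<le> A' powr p" "S y \<le> B' powr p"
        using AB A' B' p by (metis powr_mono2 order_trans zero_le_one)+
      then show ?thesis
        using t A' B' by (intro mult_left_mono add_mono) auto
    qed
    finally have "S (\<lambda>k. x k + y k) powr (1 / p) \<le> ((A' + B') powr p) powr (1 / p)"
      using S0 p by (intro powr_mono2) auto
    then show ?thesis
      using A' B' p by (simp add: powr_powr)
  qed
  have "S (\<lambda>k. x k + y k) powr (1 / p) \<le> A + B"
  proof (rule field_le_epsilon)
    fix e :: real assume "0 < e"
    then show "S (\<lambda>k. x k + y k) powr (1 / p) \<le> A + B + e"
      using main[of "A + e / 2" "B + e / 2"] AB by simp
  qed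
  then show ?thesis
    by (simp add: S_def A_def B_def)
qed

subsection \<open>The nonincreasing rearrangement of a bounded sequence\<close>

text \<open>Faithful only for bounded sequences: an infinite value of \<open>rearrangement\<close>
  is sent to 0 by \<open>enn2real\<close>.\<close>

definition rearr :: "(nat \<Rightarrow> complex) \<Rightarrow> nat \<Rightarrow> real" where
  "rearr f n = enn2real (rearrangement f n)"

lemma bounded_range_cmod: "bounded (range f) \<longleftrightarrow> (\<exists>B>0. \<forall>k. cmod (f k) \<le> B)"
  by (auto simp: bounded_pos)

lemma rearrangement_le:
  assumes "0 < s" "finite {k. s < cmod (f k)}" "card {k. s < cmod (f k)} \<le> n"
  shows "rearrangement f n \<le> ennreal s"
  unfolding rearrangement_def using assms by (intro Inf_lower) auto

text \<open>Finiteness does not depend on \<open>n\<close>: one level exceeded at only finitely many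
  indices already bounds the whole sequence.\<close>

lemma rearrangement_finite_iff: "rearrangement f n < \<infinity> \<longleftrightarrow> bounded (range f)"
proof
  assume "bounded (range f)"
  then obtain B where "B > 0" "\<forall>k. cmod (f k) \<le> B"
    unfolding bounded_range_cmod by blast
  then have "rearrangement f n \<le> ennreal B"
    by (intro rearrangement_le) (auto simp: not_less[symmetric])
  then show "rearrangement f n < \<infinity>"
    by (simp add: order_le_less_trans)
next
  assume "rearrangement f n < \<infinity>"
  then obtain s where s: "s > 0" "finite {k. s < cmod (f k)}"
    unfolding rearrangement_def Inf_less_iff by auto
  define B where "B = s + (\<Sum>k | s < cmod (f k). cmod (f k))"
  have "cmod (f k) \<le> B" for k
  proof (cases "s < cmod (f k)")
    case True
    then have "cmod (f k) \<le> (\<Sum>k | s < cmod (f k). cmod (f k))"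
      using s by (intro member_le_sum) auto
    then show ?thesis using s by (simp add: B_def)
  next
    case False
    then show ?thesis
      using sum_nonneg[of "{k. s < cmod (f k)}" "\<lambda>k. cmod (f k)"] by (simp add: B_def)
  qed
  then show "bounded (range f)"
    by (auto intro!: boundedI)
qed

lemma ennreal_rearr: "bounded (range f) \<Longrightarrow> ennreal (rearr f n) = rearrangement f n"
  using rearrangement_finite_iff[of f n] by (simp add: rearr_def)

lemma rearr_nonneg [simp]: "0 \<le> rearr f n"
  by (simp add: rearr_def)

text \<open>Together with \<open>le_rearrI\<close> this describes \<open>rearr f n\<close> by sets
  of \<open>n + 1\<close> indices on which the modulus is large, a form easier to use than the
  infimum over levels.\<close>

lemma less_rearrD:
  assumes f: "bounded (range f)" and s: "s < rearr f n"
  obtains E where "finite E" "card E = Suc n" "\<And>k. k \<in> E \<Longrightarrow> s < cmod (f k)"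
proof (cases "s < 0")
  case True
  then show ?thesis
    by (intro that[of "{..n}"]) (auto intro: less_le_trans)
next
  case False
  \<comment> \<open>Only positive levels compete in the infimum. Since \<open>s\<close> may be 0, a
    larger level is tested.\<close>
  obtain s' where s': "s < s'" "s' < rearr f n"
    using dense[OF s] by blast
  have "\<not> (finite {k. s' < cmod (f k)} \<and> card {k. s' < cmod (f k)} \<le> n)"
  proof
    assume "finite {k. s' < cmod (f k)} \<and> card {k. s' < cmod (f k)} \<le> n"
    then have "ennreal (rearr f n) \<le> ennreal s'"
      unfolding ennreal_rearr[OF f] using s' False by (intro rearrangement_le) auto
    then show False
      using s' False by simp
  qed
  then have "\<exists>E\<subseteq>{k. s' < cmod (f k)}. finite E \<and> card E = Suc n"
    by (meson Suc_leI infinite_arbitrarily_large not_le obtain_subset_with_card_n)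
  then show ?thesis
    using s'(1) that by (smt (verit) mem_Collect_eq subset_iff)
qed

lemma le_rearrI:
  assumes f: "bounded (range f)" and E: "finite E" "n < card E" "\<And>k. k \<in> E \<Longrightarrow> v \<le> cmod (f k)"
  shows "v \<le> rearr f n"
proof -
  have "ennreal v \<le> rearrangement f n"
    unfolding rearrangement_def
  proof (rule Inf_greatest)
    fix y assume "y \<in> {ennreal s | s. s > 0 \<and> finite {k. cmod (f k) > s} \<and> card {k. cmod (f k) > s} \<le> n}"
    then obtain s where y: "y = ennreal s"
      and s: "finite {k. s < cmod (f k)}" "card {k. s < cmod (f k)} \<le> n"
      by blast
    have "\<not> s < v"
    proof
      assume "s < v"
      then have "E \<subseteq> {k. s < cmod (f k)}"
        using E(3) less_le_trans by blast
      then have "card E \<le> card {k. s < cmod (f k)}"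
        by (rule card_mono[OF s(1)])
      then show False
        using s(2) E(2) by simp
    qed
    then show "ennreal v \<le> y"
      unfolding y by (intro ennreal_leI) simp
  qed
  then have "ennreal v \<le> ennreal (rearr f n)"
    by (subst ennreal_rearr[OF f])
  then show ?thesis
    using ennreal_le_iff rearr_nonneg by blast
qed

lemma rearr_antimono: "bounded (range f) \<Longrightarrow> antimono (rearr f)"
  unfolding antimono_def
proof (intro allI impI)
  fix m n :: nat
  assume f: "bounded (range f)" and "m \<le> n"
  show "rearr f n \<le> rearr f m"
  proof (rule dense_le)
    fix s assume "s < rearr f n"
    then obtain E where "finite E" "card E = Suc n" "\<And>k. k \<in> E \<Longrightarrow> s < cmod (f k)"
      using less_rearrD[OF f] by blast
    then show "s \<le> rearr f m"
      using \<open>m \<le> n\<close> by (intro le_rearrI[OF f, of E]) (auto intro: less_imp_le)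
  qed
qed

lemma cmod_le_rearr_0: "bounded (range f) \<Longrightarrow> cmod (f k) \<le> rearr f 0"
  by (rule le_rearrI[of f "{k}"]) auto

lemma rearr_le:
  assumes "bounded (range f)" "\<And>k. cmod (f k) \<le> B"
  shows "rearr f n \<le> B"
proof (rule dense_le)
  fix s assume "s < rearr f n"
  then obtain E where "card E = Suc n" "\<And>k. k \<in> E \<Longrightarrow> s < cmod (f k)"
    using less_rearrD[OF assms(1)] by blast
  then show "s \<le> B"
    using assms(2) by (metis card.empty ex_in_conv less_eq_real_def less_le_trans nat.distinct(1))
qed

lemma rearr_0_eq_0_iff: "bounded (range f) \<Longrightarrow> rearr f 0 = 0 \<longleftrightarrow> f = (\<lambda>_. 0)"
  using cmod_le_rearr_0[of f] rearr_le[of f 0 0] rearr_nonneg[of f 0]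
  by (auto simp: fun_eq_iff antisym_conv)

lemma bounded_range_cmult: "bounded (range f) \<Longrightarrow> bounded (range (\<lambda>n. c * f n :: complex))"
  using bounded_scaling[of "range f"] bounded_linear_image[of "range f" "\<lambda>x. c * x"]
  by (auto simp: image_image bounded_linear_mult_right)

lemma bounded_range_add:
  "bounded (range f) \<Longrightarrow> bounded (range g) \<Longrightarrow> bounded (range (\<lambda>n. f n + g n :: complex))"
  by (rule bounded_plus_comp)

lemma rearr_cmult:
  assumes f: "bounded (range f)"
  shows "rearr (\<lambda>n. c * f n) n = cmod c * rearr f n"
proof -
  have le: "cmod c * rearr f n \<le> rearr (\<lambda>n. c * f n) n" if f: "bounded (range f)" "c \<noteq> 0" for c f
  proof -
    have "rearr f n \<le> rearr (\<lambda>n. c * f n) n / cmod c"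
    proof (rule dense_le)
      fix s assume "s < rearr f n"
      then obtain E where "finite E" "card E = Suc n" "\<And>k. k \<in> E \<Longrightarrow> s < cmod (f k)"
        using less_rearrD[OF f(1)] by blast
      then have "cmod c * s \<le> rearr (\<lambda>n. c * f n) n"
        by (intro le_rearrI[of _ E] bounded_range_cmult f)
          (auto simp: norm_mult intro!: mult_left_mono intro: less_imp_le)
      then show "s \<le> rearr (\<lambda>n. c * f n) n / cmod c"
        using f(2) by (simp add: field_simps)
    qed
    then show ?thesis
      using f(2) by (simp add: field_simps)
  qed
  show ?thesis
  proof (cases "c = 0")
    case True
    then show ?thesis
      using rearr_le[of "\<lambda>_. 0" 0 n] rearr_nonneg[of "\<lambda>_. 0" n] by simp
  next
    case False
    have "cmod (inverse c) * rearr (\<lambda>n. c * f n) n \<le> rearr f n"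
      using le[of "\<lambda>n. c * f n" "inverse c"] False f by (simp add: bounded_range_cmult mult.assoc[symmetric])
    then have "rearr (\<lambda>n. c * f n) n \<le> cmod c * rearr f n"
      using False by (simp add: norm_inverse norm_divide field_simps)
    then show ?thesis
      using le[OF f False] by simp
  qed
qed

lemma rearr_compose_bij:
  assumes f: "bounded (range f)" and \<sigma>: "bij \<sigma>"
  shows "rearr (f \<circ> \<sigma>) n = rearr f n"
proof -
  have "card {k. s < cmod ((f \<circ> \<sigma>) k)} = card {k. s < cmod (f k)}"
    "finite {k. s < cmod ((f \<circ> \<sigma>) k)} \<longleftrightarrow> finite {k. s < cmod (f k)}" for s
  proof -
    have "bij_betw \<sigma> {k. s < cmod ((f \<circ> \<sigma>) k)} {k. s < cmod (f k)}"
      using \<sigma> by (auto simp: bij_betw_def inj_on_def bij_def image_iff)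
    then show "card {k. s < cmod ((f \<circ> \<sigma>) k)} = card {k. s < cmod (f k)}"
      "finite {k. s < cmod ((f \<circ> \<sigma>) k)} \<longleftrightarrow> finite {k. s < cmod (f k)}"
      by (auto dest: bij_betw_same_card bij_betw_finite)
  qed
  then show ?thesis
    by (simp add: rearr_def rearrangement_def)
qed

lemma rearr_of_antimono:
  fixes x :: "nat \<Rightarrow> real"
  assumes x: "antimono x" "\<And>n. 0 \<le> x n"
  shows "bounded (range (\<lambda>n. complex_of_real (x n)))"
    and "rearr (\<lambda>n. complex_of_real (x n)) n = x n"
proof -
  show bdd: "bounded (range (\<lambda>n. complex_of_real (x n)))"
    using x by (intro boundedI[of _ "x 0"]) (auto simp: antimono_def)
  show "rearr (\<lambda>n. complex_of_real (x n)) n = x n"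
  proof (rule antisym)
    show "x n \<le> rearr (\<lambda>n. complex_of_real (x n)) n"
      using x by (intro le_rearrI[OF bdd, of "{..n}"]) (auto simp: antimono_def)
    show "rearr (\<lambda>n. complex_of_real (x n)) n \<le> x n"
    proof (rule dense_le)
      fix s assume "s < rearr (\<lambda>n. complex_of_real (x n)) n"
      then obtain E where E: "finite E" "card E = Suc n" "\<And>k. k \<in> E \<Longrightarrow> s < x k"
        using less_rearrD[OF bdd] x(2) by (metis abs_of_nonneg norm_of_real)
      \<comment> \<open>A set of \<open>n + 1\<close> indices contains some \<open>k\<close> with
        \<open>n <= k\<close>, and there \<open>x k\<close> is at most \<open>x n\<close>.\<close>
      have "\<not> E \<subseteq> {..<n}"
        using card_mono[of "{..<n}" E] E(2) by auto
      then obtain k where "k \<in> E" "n \<le> k"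
        by (meson lessThan_iff not_less subsetI)
      then show "s \<le> x n"
        using E(3)[of k] x(1) by (force simp: antimono_def)
    qed
  qed
qed

text \<open>Remove an index of smallest modulus: all \<open>n + 1\<close> moduli are at least this
  one, so it is at most \<open>rearr f n\<close>.\<close>

lemma sum_cmod_le_sum_rearr:
  assumes f: "bounded (range f)" and E: "finite E"
  shows "(\<Sum>k\<in>E. cmod (f k)) \<le> (\<Sum>j<card E. rearr f j)"
  using E
proof (induction "card E" arbitrary: E)
  case (Suc n)
  then have "E \<noteq> {}" by auto
  then obtain i where i: "i \<in> E" "\<And>k. k \<in> E \<Longrightarrow> cmod (f i) \<le> cmod (f k)"
    using Suc.prems arg_min_if_finite[of E "\<lambda>k. cmod (f k)"] by (metis not_le)
  have "cmod (f i) \<le> rearr f n"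
    using Suc i by (intro le_rearrI[OF f, of E]) auto
  moreover have "(\<Sum>k\<in>E - {i}. cmod (f k)) \<le> (\<Sum>j<n. rearr f j)"
    using Suc i by (metis card_Diff_singleton diff_Suc_1 finite_Diff)
  ultimately show ?case
    using i Suc by (simp add: sum.remove[of E i] flip: Suc(2))
next
  case 0
  then have "E = {}" by (metis card_0_eq)
  then show ?case by simp
qed

text \<open>The values of the rearrangement need not be attained, hence the error \<open>e\<close>
  per term. The set grows greedily: among \<open>n + 1\<close> indices with modulus above
  \<open>rearr f n - e\<close>, one is outside the \<open>n\<close> already chosen.\<close>

lemma sum_rearr_approx:
  assumes f: "bounded (range f)" and e: "0 < e"
  shows "\<exists>E. finite E \<and> card E = n \<and> (\<Sum>j<n. rearr f j) \<le> (\<Sum>k\<in>E. cmod (f k)) + real n * e"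
proof (induction n)
  case (Suc n)
  then obtain E where E: "finite E" "card E = n"
    "(\<Sum>j<n. rearr f j) \<le> (\<Sum>k\<in>E. cmod (f k)) + real n * e" by blast
  obtain D where D: "finite D" "card D = Suc n" "\<And>k. k \<in> D \<Longrightarrow> rearr f n - e < cmod (f k)"
    using less_rearrD[OF f, of "rearr f n - e" n] e by auto
  have "\<not> D \<subseteq> E"
    using card_mono[OF E(1), of D] D E by auto
  then obtain i where i: "i \<in> D" "i \<notin> E" by blast
  show ?case
    using E D(3)[OF i(1)] i by (intro exI[of _ "insert i E"]) (simp add: algebra_simps)
next
  case 0
  show ?case by (intro exI[of _ "{}"]) simp
qed

text \<open>Up to a small error the left side is a sum of moduli over an \<open>n\<close>-element
  set, where the triangle inequality applies. The termwise inequality fails for two indicators of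
  distinct points.\<close>

lemma sum_rearr_add:
  assumes f: "bounded (range f)" and g: "bounded (range g)"
  shows "(\<Sum>j<n. rearr (\<lambda>k. f k + g k) j) \<le> (\<Sum>j<n. rearr f j + rearr g j)"
proof (rule field_le_epsilon)
  fix e :: real assume e: "0 < e"
  define d where "d = e / (real n + 1)"
  have d: "0 < d" "real n * d \<le> e"
    using e by (auto simp: d_def field_simps)
  obtain E where E: "finite E" "card E = n"
    "(\<Sum>j<n. rearr (\<lambda>k. f k + g k) j) \<le> (\<Sum>k\<in>E. cmod (f k + g k)) + real n * d"
    using sum_rearr_approx[OF bounded_range_add[OF f g] d(1)] by blast
  have "(\<Sum>k\<in>E. cmod (f k + g k)) \<le> (\<Sum>k\<in>E. cmod (f k)) + (\<Sum>k\<in>E. cmod (g k))"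
    by (simp add: norm_triangle_ineq sum_mono flip: sum.distrib)
  also have "\<dots> \<le> (\<Sum>j<n. rearr f j) + (\<Sum>j<n. rearr g j)"
    using sum_cmod_le_sum_rearr[OF f E(1)] sum_cmod_le_sum_rearr[OF g E(1)] E(2) by simp
  finally show "(\<Sum>j<n. rearr (\<lambda>k. f k + g k) j) \<le> (\<Sum>j<n. rearr f j + rearr g j) + e"
    using E(3) d(2) by (simp add: sum.distrib)
qed

subsection \<open>Lorentz functionals as suprema of finite sums\<close>

locale lorentz_weight =
  fixes \<Omega> :: "nat \<Rightarrow> real"
  assumes weight_nonneg: "0 \<le> \<Omega> n"
    and weight_0_pos: "0 < \<Omega> 0"
begin

text \<open>The index counts summands, so \<open>W n powr (1 / p)\<close> is the Lorentz functional
  of the indicator of \<open>n\<close> points.\<close>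

definition W :: "nat \<Rightarrow> real" where
  "W n = (\<Sum>k<n. \<Omega> k)"

lemma partial_weight_eq_W: "partial_weight \<Omega> n = W (Suc n)"
  by (simp add: partial_weight_def W_def lessThan_Suc_atMost)

lemma W_mono: "m \<le> n \<Longrightarrow> W m \<le> W n"
  unfolding W_def by (intro sum_mono2) (auto simp: weight_nonneg)

lemma W_pos: "0 < n \<Longrightarrow> 0 < W n"
  using W_mono[of 1 n] weight_0_pos by (simp add: W_def)

lemma W_nonneg [simp]: "0 \<le> W n"
  unfolding W_def by (intro sum_nonneg) (auto simp: weight_nonneg)

definition trunc_norm :: "real \<Rightarrow> nat \<Rightarrow> (nat \<Rightarrow> complex) \<Rightarrow> real" where
  "trunc_norm p T f = (\<Sum>n<T. rearr f n powr p * \<Omega> n) powr (1 / p)"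

text \<open>A real supremum, meaningful when the truncations are bounded; for bounded
  \<open>f\<close> and positive \<open>p\<close> this is membership in the space.\<close>

definition lorentz_real :: "real \<Rightarrow> (nat \<Rightarrow> complex) \<Rightarrow> real" where
  "lorentz_real p f = (SUP T. trunc_norm p T f)"

lemma trunc_norm_nonneg [simp]: "0 \<le> trunc_norm p T f"
  by (simp add: trunc_norm_def)

lemma trunc_norm_0 [simp]: "trunc_norm p 0 f = 0"
  by (simp add: trunc_norm_def)

lemma trunc_norm_mono:
  assumes "0 < p" "S \<le> T"
  shows "trunc_norm p S f \<le> trunc_norm p T f"
  unfolding trunc_norm_def using assms
  by (intro powr_mono2 sum_mono2 sum_nonneg) (auto simp: weight_nonneg)

lemma trunc_norm_1: "0 < p \<Longrightarrow> trunc_norm p 1 f = rearr f 0 * \<Omega> 0 powr (1 / p)"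
  by (simp add: trunc_norm_def powr_mult powr_powr)

text \<open>The positive weight \<open>\<Omega> 0\<close> makes the first term of the series
  infinite for an unbounded sequence.\<close>

lemma lorentz_space_bounded:
  assumes "f \<in> lorentz_space \<Omega> p"
  shows "bounded (range f)"
proof (rule ccontr)
  assume "\<not> bounded (range f)"
  then have "rearrangement f 0 = \<infinity>"
    using rearrangement_finite_iff[of f 0] by (metis infinity_ennreal_def top.not_eq_extremum)
  then have "ennreal_powr (rearrangement f 0) p * ennreal (\<Omega> 0) = \<infinity>"
    using weight_0_pos by (simp add: ennreal_powr_def ennreal_top_mult)
  then have "\<not> (\<Sum>n. ennreal_powr (rearrangement f n) p * ennreal (\<Omega> n)) < \<infinity>"
    using ennreal_suminf_lessD[of "\<lambda>n. ennreal_powr (rearrangement f n) p * ennreal (\<Omega> n)" \<infinity> 0]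
    by auto
  then have "(\<Sum>n. ennreal_powr (rearrangement f n) p * ennreal (\<Omega> n)) = \<infinity>"
    by (metis infinity_ennreal_def top.not_eq_extremum)
  then show False
    using assms by (simp add: lorentz_space_def lorentz_norm_def ennreal_powr_def)
qed

lemma
  assumes p: "0 < p" and f: "bounded (range f)"
  shows lorentz_space_iff_aux: "f \<in> lorentz_space \<Omega> p \<longleftrightarrow> bdd_above (range (\<lambda>T. trunc_norm p T f))"
    and lorentz_norm_eq_aux: "f \<in> lorentz_space \<Omega> p \<Longrightarrow> lorentz_norm \<Omega> p f = ennreal (lorentz_real p f)"
proof -
  define a where "a n = rearr f n powr p * \<Omega> n" for n
  have a0: "0 \<le> a n" for n
    by (simp add: a_def weight_nonneg)
  have term_eq: "ennreal_powr (rearrangement f n) p * ennreal (\<Omega> n) = ennreal (a n)" for n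
    using rearrangement_finite_iff[of f n] f
    by (simp add: a_def ennreal_powr_def rearr_def ennreal_mult' less_top)
  have norm: "lorentz_norm \<Omega> p f = ennreal_powr (\<Sum>n. ennreal (a n)) (1 / p)"
    by (simp add: lorentz_norm_def term_eq)
  have space: "f \<in> lorentz_space \<Omega> p \<longleftrightarrow> (\<Sum>n. ennreal (a n)) \<noteq> \<infinity>"
    by (auto simp: lorentz_space_def norm ennreal_powr_def)
  have summable: "f \<in> lorentz_space \<Omega> p \<longleftrightarrow> summable a"
    unfolding space infinity_ennreal_def
    using summable_suminf_not_top[of a] ennreal_suminf_neq_top[of a] a0 by blast
  have trunc: "trunc_norm p T f = (\<Sum>n<T. a n) powr (1 / p)" for T
    by (simp add: trunc_norm_def a_def)
  have lim: "(\<lambda>T. trunc_norm p T f) \<longlonglongrightarrow> (\<Sum>n. a n) powr (1 / p)" if "summable a"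
  proof -
    have "\<forall>\<^sub>F T in sequentially. 0 \<le> (\<Sum>n<T. a n)"
      by (simp add: a0 sum_nonneg)
    then show ?thesis
      unfolding trunc using p
      by (intro tendsto_powr' summable_LIMSEQ[OF that] tendsto_const) simp
  qed
  have inc: "incseq (\<lambda>T. trunc_norm p T f)"
    unfolding incseq_def using trunc_norm_mono[OF p] by blast
  show iff: "f \<in> lorentz_space \<Omega> p \<longleftrightarrow> bdd_above (range (\<lambda>T. trunc_norm p T f))"
  proof
    assume "f \<in> lorentz_space \<Omega> p"
    then show "bdd_above (range (\<lambda>T. trunc_norm p T f))"
      using summable by (intro Bseq_bdd_above convergent_imp_Bseq convergentI[OF lim]) simp
  next
    assume "bdd_above (range (\<lambda>T. trunc_norm p T f))"
    then obtain c where c: "\<And>T. trunc_norm p T f \<le> c"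
      by (auto simp: bdd_above_def)
    have "(\<Sum>n<T. a n) \<le> c powr p" for T
    proof -
      have "((\<Sum>n<T. a n) powr (1 / p)) powr p \<le> c powr p"
        using c[of T] p by (intro powr_mono2) (auto simp: trunc)
      then show ?thesis
        using p a0 by (simp add: powr_powr sum_nonneg)
    qed
    then show "f \<in> lorentz_space \<Omega> p"
      unfolding summable using a0 by (intro bounded_imp_summable[of _ "c powr p"])
        (auto simp: lessThan_Suc_atMost[symmetric] simp del: sum.lessThan_Suc)
  qed
  show "lorentz_norm \<Omega> p f = ennreal (lorentz_real p f)" if "f \<in> lorentz_space \<Omega> p"
  proof -
    have "(\<lambda>T. trunc_norm p T f) \<longlonglongrightarrow> lorentz_real p f"
      unfolding lorentz_real_def using that iff inc by (intro LIMSEQ_incseq_SUP) auto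
    then have "lorentz_real p f = (\<Sum>n. a n) powr (1 / p)"
      using lim that summable LIMSEQ_unique by blast
    moreover have "(\<Sum>n. ennreal (a n)) = ennreal (\<Sum>n. a n)"
      using that a0 space by (intro suminf_ennreal) auto
    moreover have "0 \<le> (\<Sum>n. a n)"
      using that a0 summable by (intro suminf_nonneg) auto
    ultimately show ?thesis
      by (simp add: norm ennreal_powr_def)
  qed
qed

lemma lorentz_space_iff:
  "0 < p \<Longrightarrow> f \<in> lorentz_space \<Omega> p
    \<longleftrightarrow> bounded (range f) \<and> bdd_above (range (\<lambda>T. trunc_norm p T f))"
  using lorentz_space_iff_aux[of p f] lorentz_space_bounded[of f p] by auto

lemma lorentz_norm_eq:
  "0 < p \<Longrightarrow> f \<in> lorentz_space \<Omega> p \<Longrightarrow> lorentz_norm \<Omega> p f = ennreal (lorentz_real p f)"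
  using lorentz_norm_eq_aux[of p f] lorentz_space_bounded[of f p] by auto

lemma trunc_norm_le_lorentz_real:
  "0 < p \<Longrightarrow> f \<in> lorentz_space \<Omega> p \<Longrightarrow> trunc_norm p T f \<le> lorentz_real p f"
  unfolding lorentz_real_def by (intro cSUP_upper) (auto simp: lorentz_space_iff)

lemma lorentz_real_nonneg: "0 < p \<Longrightarrow> f \<in> lorentz_space \<Omega> p \<Longrightarrow> 0 \<le> lorentz_real p f"
  using trunc_norm_le_lorentz_real[of p f 0] by simp

lemma lorentz_real_le: "(\<And>T. trunc_norm p T f \<le> c) \<Longrightarrow> lorentz_real p f \<le> c"
  unfolding lorentz_real_def by (intro cSUP_least) auto

lemma lorentz_normable_iff:
  assumes p: "0 < p"
  shows "lorentz_normable \<Omega> p \<longleftrightarrow> linear_sequence_space (lorentz_space \<Omega> p) \<and>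
     (\<exists>N. norm_on (lorentz_space \<Omega> p) N \<and>
        (\<exists>a>0. \<exists>b>0. \<forall>f\<in>lorentz_space \<Omega> p.
           a * lorentz_real p f \<le> N f \<and> N f \<le> b * lorentz_real p f))"
proof -
  have e: "ennreal a * lorentz_norm \<Omega> p f \<le> ennreal (N f) \<longleftrightarrow> a * lorentz_real p f \<le> N f"
      "ennreal (N f) \<le> ennreal b * lorentz_norm \<Omega> p f \<longleftrightarrow> N f \<le> b * lorentz_real p f"
    if "norm_on (lorentz_space \<Omega> p) N" "0 < a" "0 < b" "f \<in> lorentz_space \<Omega> p" for N a b f
  proof -
    have "0 \<le> N f"
      using that by (auto simp: norm_on_def)
    then show "ennreal a * lorentz_norm \<Omega> p f \<le> ennreal (N f) \<longleftrightarrow> a * lorentz_real p f \<le> N f"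
      "ennreal (N f) \<le> ennreal b * lorentz_norm \<Omega> p f \<longleftrightarrow> N f \<le> b * lorentz_real p f"
      using that p lorentz_real_nonneg[OF p that(4)]
      by (simp_all add: lorentz_norm_eq flip: ennreal_mult')
  qed
  show ?thesis
    unfolding lorentz_normable_def by (intro conj_cong refl ex_cong1 ball_cong) (simp_all add: e)
qed

subsection \<open>Normability and sums of finitely many sequences\<close>

text \<open>The norm is the supremum \<open>M\<close> of the \<open>N T\<close>. The two comparisons
  make it finite exactly on the Lorentz space, so closure under sums and scalars follows from the
  properties of the \<open>N T\<close>. The truncation \<open>T'\<close> may depend on
  \<open>T\<close> and \<open>f\<close>.\<close>

lemma lorentz_normableI:
  fixes N :: "nat \<Rightarrow> (nat \<Rightarrow> complex) \<Rightarrow> real"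
  assumes p: "0 < p" and ab: "0 < a" "0 < b"
    and N_add: "\<And>T f g. bounded (range f) \<Longrightarrow> bounded (range g) \<Longrightarrow>
      N T (\<lambda>n. f n + g n) \<le> N T f + N T g"
    and N_cmult: "\<And>T c f. bounded (range f) \<Longrightarrow> N T (\<lambda>n. c * f n) = cmod c * N T f"
    and upper: "\<And>T f. bounded (range f) \<Longrightarrow> \<exists>T'. N T f \<le> b * trunc_norm p T' f"
    and lower: "\<And>T f. bounded (range f) \<Longrightarrow> \<exists>T'. trunc_norm p T f \<le> a * N T' f"
  shows "lorentz_normable \<Omega> p"
proof -
  let ?V = "lorentz_space \<Omega> p"
  define M where "M f = (SUP T. N T f)" for f
  have V_bdd: "bounded (range f)" if "f \<in> ?V" for f
    using that by (rule lorentz_space_bounded)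
  have bdd: "bdd_above (range (\<lambda>T. N T f))" if f: "f \<in> ?V" for f
  proof (rule bdd_aboveI2)
    fix T
    obtain T' where "N T f \<le> b * trunc_norm p T' f"
      using upper[OF V_bdd[OF f]] by blast
    also have "\<dots> \<le> b * lorentz_real p f"
      using ab p f by (intro mult_left_mono trunc_norm_le_lorentz_real) auto
    finally show "N T f \<le> b * lorentz_real p f" .
  qed
  have N_le_M: "N T f \<le> M f" if "f \<in> ?V" for f T
    unfolding M_def using bdd[OF that] by (intro cSUP_upper) auto
  have VI: "f \<in> ?V" if f: "bounded (range f)" and c: "\<And>T. N T f \<le> c" for f c
    unfolding lorentz_space_iff[OF p]
  proof (intro conjI f bdd_aboveI2)
    fix T
    obtain T' where "trunc_norm p T f \<le> a * N T' f"
      using lower[OF f] by blast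
    also have "\<dots> \<le> a * c"
      using ab c by (intro mult_left_mono) auto
    finally show "trunc_norm p T f \<le> a * c" .
  qed
  have M_le: "M f \<le> c" if "\<And>T. N T f \<le> c" for f c
    unfolding M_def using that by (intro cSUP_least) auto
  have trunc_le: "trunc_norm p T f \<le> a * M f" if f: "f \<in> ?V" for f T
  proof -
    obtain T' where "trunc_norm p T f \<le> a * N T' f"
      using lower[OF V_bdd[OF f]] by blast
    also have "\<dots> \<le> a * M f"
      using ab N_le_M f by (intro mult_left_mono) auto
    finally show ?thesis .
  qed
  have M_nonneg: "0 \<le> M f" if "f \<in> ?V" for f
    using trunc_le[OF that, of 0] ab by (simp add: zero_le_mult_iff)
  have N_zero: "N T (\<lambda>_. 0) = 0" for T
    using N_cmult[of "\<lambda>_. 0" T 0] by simp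
  have zero: "(\<lambda>_. 0) \<in> ?V"
    using N_zero by (intro VI[of _ 0]) auto
  have add: "(\<lambda>n. f n + g n) \<in> ?V" "M (\<lambda>n. f n + g n) \<le> M f + M g" if "f \<in> ?V" "g \<in> ?V" for f g
  proof -
    have "N T (\<lambda>n. f n + g n) \<le> M f + M g" for T
      using N_add[OF V_bdd V_bdd, OF that, of T] N_le_M[OF that(1), of T] N_le_M[OF that(2), of T]
      by simp
    then show "(\<lambda>n. f n + g n) \<in> ?V" "M (\<lambda>n. f n + g n) \<le> M f + M g"
      using that by (auto intro: VI M_le bounded_range_add V_bdd)
  qed
  have cmult: "(\<lambda>n. c * f n) \<in> ?V" "M (\<lambda>n. c * f n) \<le> cmod c * M f" if "f \<in> ?V" for c f
  proof -
    have "N T (\<lambda>n. c * f n) \<le> cmod c * M f" for T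
      unfolding N_cmult[OF V_bdd[OF that]] by (intro mult_left_mono N_le_M that) auto
    then show "(\<lambda>n. c * f n) \<in> ?V" "M (\<lambda>n. c * f n) \<le> cmod c * M f"
      using that by (auto intro: VI M_le bounded_range_cmult V_bdd)
  qed
  have cmult_eq: "M (\<lambda>n. c * f n) = cmod c * M f" if "f \<in> ?V" for c f
  proof (cases "c = 0")
    case True
    then show ?thesis
      using cmult(2)[OF that, of 0] M_nonneg[OF cmult(1)[OF that, of 0]] by simp
  next
    case False
    have "M f \<le> cmod (inverse c) * M (\<lambda>n. c * f n)"
      using cmult(2)[OF cmult(1)[OF that, of c], of "inverse c"] False
      by (simp add: mult.assoc[symmetric])
    then have "cmod c * M f \<le> M (\<lambda>n. c * f n)"
      using False by (simp add: norm_inverse norm_divide field_simps)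
    then show ?thesis
      using cmult(2)[OF that, of c] by simp
  qed
  have definite: "f = (\<lambda>_. 0)" if "f \<in> ?V" "M f = 0" for f
  proof -
    have "rearr f 0 * \<Omega> 0 powr (1 / p) \<le> 0"
      using trunc_le[OF that(1), of 1] that(2) p by (simp add: trunc_norm_1[simplified])
    then have "rearr f 0 = 0"
      using weight_0_pos rearr_nonneg[of f 0] by (simp add: mult_le_0_iff)
    then show ?thesis
      using rearr_0_eq_0_iff V_bdd that(1) by blast
  qed
  have M_zero: "M (\<lambda>_. 0) = 0"
    using N_zero by (simp add: M_def)
  have "linear_sequence_space ?V"
    using zero add(1) cmult(1) by (simp add: linear_sequence_space_def)
  moreover have "norm_on ?V M"
    using M_nonneg cmult_eq add(2) definite M_zero by (auto simp: norm_on_def)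
  moreover have "inverse a * lorentz_real p f \<le> M f" "M f \<le> b * lorentz_real p f"
    if f: "f \<in> ?V" for f
  proof -
    have "lorentz_real p f \<le> a * M f"
      by (intro lorentz_real_le trunc_le f)
    then show "inverse a * lorentz_real p f \<le> M f"
      using ab by (simp add: field_simps)
    show "M f \<le> b * lorentz_real p f"
    proof (rule M_le)
      fix T
      obtain T' where "N T f \<le> b * trunc_norm p T' f"
        using upper[OF V_bdd[OF f]] by blast
      also have "\<dots> \<le> b * lorentz_real p f"
        using ab p f by (intro mult_left_mono trunc_norm_le_lorentz_real) auto
      finally show "N T f \<le> b * lorentz_real p f" .
    qed
  qed
  ultimately show ?thesis
    unfolding lorentz_normable_iff[OF p] using ab
    by (intro conjI exI[of _ M] exI[of _ "inverse a"] exI[of _ b] ballI) auto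
qed

text \<open>Passing to the norm and back costs the factor \<open>b / a\<close> once, so the constant
  is independent of the number \<open>J\<close> of summands.\<close>

lemma lorentz_normableD:
  assumes p: "0 < p" and n: "lorentz_normable \<Omega> p"
  obtains C where "0 < C"
    "\<And>F (J :: nat). (\<And>j. j < J \<Longrightarrow> F j \<in> lorentz_space \<Omega> p) \<Longrightarrow>
      (\<lambda>n. \<Sum>j<J. F j n) \<in> lorentz_space \<Omega> p \<and>
      lorentz_real p (\<lambda>n. \<Sum>j<J. F j n) \<le> C * (\<Sum>j<J. lorentz_real p (F j))"
proof -
  let ?V = "lorentz_space \<Omega> p"
  obtain N a b where N: "linear_sequence_space ?V" "norm_on ?V N" "0 < a" "0 < b"
    "\<And>f. f \<in> ?V \<Longrightarrow> a * lorentz_real p f \<le> N f"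
    "\<And>f. f \<in> ?V \<Longrightarrow> N f \<le> b * lorentz_real p f"
    using n unfolding lorentz_normable_iff[OF p] by blast
  have sum: "(\<lambda>n. \<Sum>j<J. F j n) \<in> ?V \<and> N (\<lambda>n. \<Sum>j<J. F j n) \<le> (\<Sum>j<J. N (F j))"
    if "\<And>j. j < J \<Longrightarrow> F j \<in> ?V" for F :: "nat \<Rightarrow> nat \<Rightarrow> complex" and J
    using that
  proof (induction J)
    case 0
    then show ?case
      using N(1,2) by (auto simp: linear_sequence_space_def norm_on_def)
  next
    case (Suc J)
    define G where "G = (\<lambda>n. \<Sum>j<J. F j n)"
    have IH: "G \<in> ?V" "N G \<le> (\<Sum>j<J. N (F j))" "F J \<in> ?V"
      unfolding G_def using Suc by auto
    have "N (\<lambda>n. G n + F J n) \<le> N G + N (F J)"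
      using N(2) IH unfolding norm_on_def by blast
    moreover have "(\<lambda>n. G n + F J n) \<in> ?V"
      using N(1) IH unfolding linear_sequence_space_def by blast
    moreover have "(\<lambda>n. \<Sum>j<Suc J. F j n) = (\<lambda>n. G n + F J n)"
      by (simp add: G_def)
    ultimately show ?case
      using IH(2) by simp
  qed
  show ?thesis
  proof (rule that[of "b / a"])
    fix F and J :: nat
    assume F: "\<And>j. j < J \<Longrightarrow> F j \<in> ?V"
    define G where "G = (\<lambda>n. \<Sum>j<J. F j n)"
    have G: "G \<in> ?V" "N G \<le> (\<Sum>j<J. N (F j))"
      unfolding G_def using sum[of J F] F by auto
    have "a * lorentz_real p G \<le> N G"
      by (rule N(5)[OF G(1)])
    also have "\<dots> \<le> (\<Sum>j<J. b * lorentz_real p (F j))"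
      by (rule order_trans[OF G(2)], rule sum_mono, rule N(6), rule F) simp
    finally have "lorentz_real p G \<le> b / a * (\<Sum>j<J. lorentz_real p (F j))"
      unfolding sum_distrib_left[symmetric] using N(3) by (simp add: pos_le_divide_eq mult.commute)
    then show "(\<lambda>n. \<Sum>j<J. F j n) \<in> ?V \<and>
      lorentz_real p (\<lambda>n. \<Sum>j<J. F j n) \<le> b / a * (\<Sum>j<J. lorentz_real p (F j))"
      using G(1) unfolding G_def by blast
  qed (use N(3,4) in simp)
qed

lemma
  fixes x :: "nat \<Rightarrow> real"
  assumes p: "0 < p" and f: "bounded (range f)" "\<And>k. rearr f k = x k" and supp: "\<And>k. n \<le> k \<Longrightarrow> x k = 0"
  shows finite_support_in_lorentz_space: "f \<in> lorentz_space \<Omega> p"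
    and lorentz_real_finite_support:
      "lorentz_real p f = (\<Sum>k<n. x k powr p * \<Omega> k) powr (1 / p)"
proof -
  have eq: "trunc_norm p T f = (\<Sum>k<n. x k powr p * \<Omega> k) powr (1 / p)" if "n \<le> T" for T
  proof -
    have "(\<Sum>k<T. x k powr p * \<Omega> k) = (\<Sum>k<n. x k powr p * \<Omega> k)"
      using that supp by (intro sum.mono_neutral_right) auto
    then show ?thesis
      by (simp add: trunc_norm_def f(2))
  qed
  have le: "trunc_norm p T f \<le> (\<Sum>k<n. x k powr p * \<Omega> k) powr (1 / p)" for T
    using trunc_norm_mono[OF p, of T "max n T" f] eq[of "max n T"] by simp
  show V: "f \<in> lorentz_space \<Omega> p"
    unfolding lorentz_space_iff[OF p] using f(1) le by (auto intro!: bdd_aboveI2)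
  show "lorentz_real p f = (\<Sum>k<n. x k powr p * \<Omega> k) powr (1 / p)"
    using lorentz_real_le[of p f, OF le] trunc_norm_le_lorentz_real[OF p V, of n] eq[of n] by simp
qed

subsection \<open>Weight conditions sufficient for normability\<close>

lemma trunc_norm_le_rearr_0:
  assumes p: "0 < p" and f: "bounded (range f)" and \<Omega>: "summable \<Omega>"
  shows "trunc_norm p T f \<le> suminf \<Omega> powr (1 / p) * rearr f 0"
proof -
  have "rearr f n \<le> rearr f 0" for n
    using rearr_antimono[OF f] by (simp add: antimono_def)
  then have "(\<Sum>n<T. rearr f n powr p * \<Omega> n) \<le> (\<Sum>n<T. rearr f 0 powr p * \<Omega> n)"
    using p by (intro sum_mono mult_right_mono powr_mono2) (auto simp: weight_nonneg)
  also have "\<dots> \<le> rearr f 0 powr p * suminf \<Omega>"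
    unfolding sum_distrib_left[symmetric] using \<Omega>
    by (intro mult_left_mono sum_le_suminf) (auto simp: weight_nonneg)
  finally have "trunc_norm p T f \<le> (rearr f 0 powr p * suminf \<Omega>) powr (1 / p)"
    unfolding trunc_norm_def using p by (intro powr_mono2 sum_nonneg) (auto simp: weight_nonneg)
  also have "\<dots> = suminf \<Omega> powr (1 / p) * rearr f 0"
    using p by (simp add: powr_mult powr_powr)
  finally show ?thesis .
qed

text \<open>The family of norms is constant in \<open>T\<close>: \<open>rearr f 0\<close> is the
  supremum of the moduli, and its subadditivity is \<open>sum_rearr_add\<close> with one
  term.\<close>

lemma normable_if_summable:
  assumes p: "0 < p" and \<Omega>: "summable \<Omega>"
  shows "lorentz_normable \<Omega> p"
proof (rule lorentz_normableI[OF p, of "suminf \<Omega> powr (1 / p)" "1 / \<Omega> 0 powr (1 / p)" "\<lambda>_ f. rearr f 0"])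
  have "\<Omega> 0 \<le> suminf \<Omega>"
    using sum_le_suminf[OF \<Omega>, of "{0}"] weight_nonneg by simp
  then show "0 < suminf \<Omega> powr (1 / p)"
    using weight_0_pos by simp
  show "0 < 1 / \<Omega> 0 powr (1 / p)"
    using weight_0_pos by simp
next
  fix f g :: "nat \<Rightarrow> complex"
  assume "bounded (range f)" "bounded (range g)"
  then show "rearr (\<lambda>n. f n + g n) 0 \<le> rearr f 0 + rearr g 0"
    using sum_rearr_add[of f g 1] by simp
next
  fix f :: "nat \<Rightarrow> complex"
  assume f: "bounded (range f)"
  show "rearr (\<lambda>n. c * f n) 0 = cmod c * rearr f 0" for c
    using f by (rule rearr_cmult)
  show "\<exists>T'. rearr f 0 \<le> 1 / \<Omega> 0 powr (1 / p) * trunc_norm p T' f"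
    using weight_0_pos p by (intro exI[of _ 1]) (simp add: trunc_norm_1[simplified])
  show "\<exists>T'::nat. trunc_norm p T f \<le> suminf \<Omega> powr (1 / p) * rearr f 0" for T
    using trunc_norm_le_rearr_0[OF p f \<Omega>] by blast
qed

lemma lorentz_space_eq_linf:
  assumes p: "0 < p" and \<Omega>: "summable \<Omega>"
  shows "lorentz_space \<Omega> p = little_linf"
proof -
  have "bdd_above (range (\<lambda>T. trunc_norm p T f))" if "bounded (range f)" for f
    using trunc_norm_le_rearr_0[OF p that \<Omega>] by (intro bdd_aboveI2)
  then show ?thesis
    unfolding little_linf_def using lorentz_space_iff[OF p] by blast
qed

section \<open>Exponent 1: concave majorants\<close>

text \<open>\<open>U\<close> is, up to the value at 0, the infimum of the affine functions above \<open>W\<close>: it is concave and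
  comparable to \<open>W\<close>.\<close>

lemma concave_majorant:
  assumes K: "\<And>m n. 0 < m \<Longrightarrow> m \<le> n \<Longrightarrow> W n / real n \<le> K * (W m / real m)"
  obtains U where "U 0 = 0" "\<And>n. W n \<le> U n" "\<And>n. U n \<le> (1 + K) * W n"
    "\<And>n. U n \<le> U (Suc n)" "\<And>n. U n + U (Suc (Suc n)) \<le> 2 * U (Suc n)"
proof -
  define P where "P = {(a :: real, b :: real). 0 \<le> a \<and> 0 \<le> b \<and> (\<forall>k. W k \<le> a + b * real k)}"
  define V where "V n = (INF (a, b)\<in>P. a + b * real n)" for n :: nat
  \<comment> \<open>The value 0 at 0 lets the increments of \<open>U\<close> add up to
    \<open>U n\<close>. Lowering the value at an endpoint preserves concavity.\<close>
  define U where "U n = (if n = 0 then 0 else V n)" for n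
  have K0: "0 < K"
    using K[of 1 1] W_pos[of 1] by (simp add: zero_less_mult_iff)
  \<comment> \<open>The constant term dominates \<open>W k\<close> for \<open>k <= n\<close> by
    monotonicity, the linear term for larger \<open>k\<close> by hypothesis. At \<open>n\<close>
    this affine function equals \<open>(1 + K) * W n\<close>.\<close>
  have mem: "(W n, K * (W n / real n)) \<in> P" if n: "0 < n" for n
  proof -
    have "W k \<le> W n + K * (W n / real n) * real k" for k
    proof (cases "k \<le> n")
      case True
      then show ?thesis
        using W_mono[OF True] K0 by (simp add: add_increasing2)
    next
      case False
      then have "W k \<le> K * (W n / real n) * real k"
        using K[OF n, of k] n by (simp add: pos_divide_le_eq)
      then show ?thesis by (simp add: add_increasing)
    qed
    then show ?thesis
      using K0 by (simp add: P_def)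
  qed
  then have ne: "P \<noteq> {}" by blast
  have V_le: "V n \<le> a + b * real n" if "(a, b) \<in> P" for a b n
    unfolding V_def
    by (rule cINF_lower2[OF _ that]) (auto simp: P_def intro!: bdd_belowI2[of _ 0])
  have le_V: "c \<le> V n" if "\<And>a b. (a, b) \<in> P \<Longrightarrow> c \<le> a + b * real n" for c n
    unfolding V_def using ne that by (intro cINF_greatest) auto
  show ?thesis
  proof
    show "U 0 = 0" by (simp add: U_def)
    show "W n \<le> U n" for n
      by (auto simp: U_def W_def[of 0] P_def intro!: le_V)
    show "U n \<le> (1 + K) * W n" for n
      using V_le[OF mem, of n n] by (auto simp: U_def W_def[of 0] algebra_simps)
    show "U n \<le> U (Suc n)" for n
    proof -
      have "V n \<le> V (Suc n)"
      proof (rule le_V)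
        fix a b assume ab: "(a, b) \<in> P"
        then have "b * real n \<le> b * real (Suc n)"
          by (intro mult_left_mono) (auto simp: P_def)
        then show "V n \<le> a + b * real (Suc n)"
          using V_le[OF ab, of n] by simp
      qed
      moreover have "0 \<le> V (Suc n)"
        by (intro le_V) (auto simp: P_def)
      ultimately show ?thesis
        by (cases n) (simp_all add: U_def)
    qed
    show "U n + U (Suc (Suc n)) \<le> 2 * U (Suc n)" for n
    proof -
      have "(U n + U (Suc (Suc n))) / 2 \<le> V (Suc n)"
      proof (rule le_V)
        fix a b assume ab: "(a, b) \<in> P"
        then have "U n \<le> a + b * real n"
          using V_le[OF ab, of n] by (auto simp: U_def P_def)
        then show "(U n + U (Suc (Suc n))) / 2 \<le> a + b * real (Suc n)"
          using V_le[OF ab, of "Suc (Suc n)"] by (simp add: U_def algebra_simps)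
      qed
      then show ?thesis
        by (simp add: U_def)
    qed
  qed
qed

lemma trunc_norm_1_eq: "trunc_norm 1 T f = (\<Sum>n<T. rearr f n * \<Omega> n)"
  by (simp add: trunc_norm_def sum_nonneg weight_nonneg)

text \<open>The increments \<open>w\<close> of the concave majorant form a decreasing weight, so
  Hardy's lemma makes its functional subadditive. Comparability of \<open>U\<close> and
  \<open>W\<close> passes to the functionals because rearrangements decrease.\<close>

lemma normable_1_if_quasi_decreasing:
  assumes K: "\<And>m n. 0 < m \<Longrightarrow> m \<le> n \<Longrightarrow> W n / real n \<le> K * (W m / real m)"
  shows "lorentz_normable \<Omega> 1"
proof -
  obtain U where U: "U 0 = 0" "\<And>n. W n \<le> U n" "\<And>n. U n \<le> (1 + K) * W n"
    "\<And>n. U n \<le> U (Suc n)" "\<And>n. U n + U (Suc (Suc n)) \<le> 2 * U (Suc n)"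
    using concave_majorant[OF K] by blast
  define w where "w n = U (Suc n) - U n" for n
  have w: "antimono w" "\<And>n. 0 \<le> w n"
  proof -
    show "antimono w"
      unfolding decseq_Suc_iff using U(5) by (simp add: w_def algebra_simps)
    show "0 \<le> w n" for n
      using U(4) by (simp add: w_def)
  qed
  have sum_w: "(\<Sum>k<n. w k) = U n" for n
    unfolding w_def using sum_lessThan_telescope[of U n] U(1) by simp
  have K0: "0 < K"
    using K[of 1 1] W_pos[of 1] by (simp add: zero_less_mult_iff)
  show ?thesis
  proof (rule lorentz_normableI[of 1 1 "1 + K" "\<lambda>T f. \<Sum>n<T. rearr f n * w n"])
    fix T and f g :: "nat \<Rightarrow> complex"
    assume "bounded (range f)" "bounded (range g)"
    then have "(\<Sum>n<T. w n * rearr (\<lambda>n. f n + g n) n) \<le> (\<Sum>n<T. w n * (rearr f n + rearr g n))"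
      by (intro sum_mult_antimono_mono w sum_rearr_add)
    then show "(\<Sum>n<T. rearr (\<lambda>n. f n + g n) n * w n)
      \<le> (\<Sum>n<T. rearr f n * w n) + (\<Sum>n<T. rearr g n * w n)"
      by (simp add: algebra_simps sum.distrib)
  next
    fix T c and f :: "nat \<Rightarrow> complex"
    assume f: "bounded (range f)"
    show "(\<Sum>n<T. rearr (\<lambda>n. c * f n) n * w n) = cmod c * (\<Sum>n<T. rearr f n * w n)"
      by (simp add: rearr_cmult[OF f] sum_distrib_left mult.assoc)
    have "(\<Sum>n<T. rearr f n * w n) \<le> (\<Sum>n<T. rearr f n * ((1 + K) * \<Omega> n))"
      using U(3) by (intro sum_mult_antimono_mono rearr_antimono[OF f] rearr_nonneg)
        (simp add: sum_w W_def flip: sum_distrib_left)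
    also have "\<dots> = (1 + K) * trunc_norm 1 T f"
      unfolding trunc_norm_1_eq sum_distrib_left by (intro sum.cong) auto
    finally show "\<exists>T'. (\<Sum>n<T. rearr f n * w n) \<le> (1 + K) * trunc_norm 1 T' f"
      by blast
    have "trunc_norm 1 T f \<le> (\<Sum>n<T. rearr f n * w n)"
      unfolding trunc_norm_1_eq using U(2)
      by (intro sum_mult_antimono_mono rearr_antimono[OF f] rearr_nonneg) (simp add: sum_w flip: W_def)
    then show "\<exists>T'. trunc_norm 1 T f \<le> 1 * (\<Sum>n<T'. rearr f n * w n)"
      by auto
  qed (use K0 in auto)
qed

section \<open>Exponents at least 1: dilations and averages\<close>

lemma sum_dilation_le:
  assumes x: "antimono x" "\<And>n. 0 \<le> x n"
    and K: "0 < K" "\<And>m. W (K * m) \<le> c * W m"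
  shows "(\<Sum>n<T. x (n div K) * \<Omega> n) \<le> c * (\<Sum>m<T. x m * \<Omega> m)"
proof -
  have "(\<Sum>n<T. x (n div K) * \<Omega> n) \<le> (\<Sum>n<T * K. x (n div K) * \<Omega> n)"
    using K(1) x(2) by (intro sum_mono2) (auto simp: weight_nonneg intro: less_le_trans)
  also have "\<dots> = (\<Sum>m<T. \<Sum>n=m * K..<m * K + K. x (n div K) * \<Omega> n)"
    by (rule sum.nat_group[symmetric])
  also have "\<dots> = (\<Sum>m<T. x m * (\<Sum>n=m * K..<m * K + K. \<Omega> n))"
  proof (rule sum.cong)
    fix m
    have "n div K = m" if "n \<in> {m * K..<m * K + K}" for n
      using that K(1) by (intro div_nat_eqI) (auto simp: algebra_simps)
    then show "(\<Sum>n=m * K..<m * K + K. x (n div K) * \<Omega> n) = x m * (\<Sum>n=m * K..<m * K + K. \<Omega> n)"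
      by (simp add: sum_distrib_left)
  qed simp
  \<comment> \<open>Hardy's lemma for the sums of the weight over blocks of length \<open>K\<close>,
    whose partial sums are the values \<open>W (K * M)\<close>.\<close>
  also have "\<dots> \<le> (\<Sum>m<T. x m * (c * \<Omega> m))"
  proof (intro sum_mult_antimono_mono x)
    fix M
    have "(\<Sum>m<M. \<Sum>n=m * K..<m * K + K. \<Omega> n) = W (K * M)"
      by (simp add: sum.nat_group W_def mult.commute)
    also have "\<dots> \<le> (\<Sum>m<M. c * \<Omega> m)"
      using K(2)[of M] by (simp add: W_def sum_distrib_left)
    finally show "(\<Sum>m<M. \<Sum>n=m * K..<m * K + K. \<Omega> n) \<le> (\<Sum>m<M. c * \<Omega> m)" .
  qed
  finally show ?thesis
    by (simp add: sum_distrib_left algebra_simps)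
qed

text \<open>With \<open>F\<close> the sequence of averages of \<open>x\<close>, splitting the average at \<open>n div K\<close> gives
  \<open>F n \<le> (2 / K) * F (n div K) + x (n div K)\<close>. Dilation by \<open>K\<close> costs a factor \<open>K / 4\<close>, so the
  first summand is absorbed into the left-hand side.\<close>

lemma Hardy_inequality_antimono:
  fixes x :: "nat \<Rightarrow> real"
  assumes p: "1 \<le> p" and x: "antimono x" "\<And>n. 0 \<le> x n"
    and K: "0 < K" "\<And>m. W (K * m) powr (1 / p) \<le> real K / 4 * W m powr (1 / p)"
  defines "F \<equiv> \<lambda>n. (\<Sum>k<Suc n. x k) / real (Suc n)"
  shows "(\<Sum>n<T. F n powr p * \<Omega> n) powr (1 / p)
    \<le> real K / 2 * (\<Sum>n<T. x n powr p * \<Omega> n) powr (1 / p)"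
proof -
  define S where "S y = (\<Sum>n<T. y n powr p * \<Omega> n) powr (1 / p)" for y :: "nat \<Rightarrow> real"
  have F0: "0 \<le> F n" for n
    unfolding F_def using x(2) by (intro divide_nonneg_nonneg sum_nonneg) auto
  have F_anti: "antimono F"
    unfolding decseq_Suc_iff
  proof
    fix n
    have "real (Suc n) * x (Suc n) = (\<Sum>k<Suc n. x (Suc n))"
      by simp
    also have "\<dots> \<le> (\<Sum>k<Suc n. x k)"
      using x(1) by (intro sum_mono) (auto simp: antimono_def)
    finally show "F (Suc n) \<le> F n"
      unfolding F_def sum.lessThan_Suc[of x "Suc n"]
      by (simp add: field_simps del: sum.lessThan_Suc)
  qed
  have dilation: "S (\<lambda>n. y (n div K)) \<le> real K / 4 * S y" if y: "antimono y" "\<And>n. 0 \<le> y n" for y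
  proof -
    have c: "W (K * m) \<le> (real K / 4) powr p * W m" for m
    proof -
      have "(W (K * m) powr (1 / p)) powr p \<le> (real K / 4 * W m powr (1 / p)) powr p"
        using p K(2) by (intro powr_mono2) auto
      then show ?thesis
        unfolding powr_mult using p by (simp add: powr_powr)
    qed
    have "antimono (\<lambda>n. y n powr p)"
      using y p by (auto simp: antimono_def intro!: powr_mono2)
    then have "(\<Sum>n<T. y (n div K) powr p * \<Omega> n) \<le> (real K / 4) powr p * (\<Sum>n<T. y n powr p * \<Omega> n)"
      by (intro sum_dilation_le K c) auto
    then have "S (\<lambda>n. y (n div K)) \<le> ((real K / 4) powr p * (\<Sum>n<T. y n powr p * \<Omega> n)) powr (1 / p)"
      unfolding S_def using p by (intro powr_mono2 sum_nonneg) (auto simp: weight_nonneg)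
    then show ?thesis
      using p by (simp add: S_def powr_mult powr_powr)
  qed
  have rec: "F n \<le> 2 / real K * F (n div K) + x (n div K)" for n
  proof (cases "n div K = 0")
    case True
    have "(\<Sum>k<Suc n. x k) \<le> (\<Sum>k<Suc n. x 0)"
      using x(1) by (intro sum_mono) (auto simp: antimono_def)
    then have "F n \<le> x 0"
      by (simp add: F_def field_simps del: sum.lessThan_Suc)
    moreover have "0 \<le> 2 / real K * F (n div K)"
      using F0 by simp
    ultimately show ?thesis
      using True by simp
  next
    case False
    define m where "m = n div K"
    have m: "0 < m" "m \<le> n" "K * m \<le> n"
      using False K(1) by (auto simp: m_def)
    have "(\<Sum>k<Suc n. x k) = (\<Sum>k<Suc m. x k) + (\<Sum>k=Suc m..<Suc n. x k)"
      using m sum.atLeastLessThan_concat[of 0 "Suc m" "Suc n" x] by (simp add: atLeast0LessThan)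
    also have "(\<Sum>k=Suc m..<Suc n. x k) \<le> (\<Sum>k=Suc m..<Suc n. x m)"
      using x(1) by (intro sum_mono) (auto simp: antimono_def)
    also have "\<dots> \<le> real (Suc n) * x m"
      using x(2) by (auto intro!: mult_right_mono)
    also have "(\<Sum>k<Suc m. x k) = real (Suc m) * F m"
      by (simp add: F_def del: sum.lessThan_Suc)
    also have "real (Suc m) \<le> 2 / real K * real (Suc n)"
    proof -
      \<comment> \<open>The factor 2 comes from \<open>Suc m <= 2 * m\<close>, which is why
        \<open>n div K = 0\<close> is a separate case.\<close>
      have "K * Suc m \<le> 2 * Suc n"
      proof -
        have "K * Suc m \<le> K * (2 * m)"
          using m by (intro mult_left_mono) auto
        also have "\<dots> = 2 * (K * m)"
          by simp
        also have "\<dots> \<le> 2 * Suc n"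
          using m by (intro mult_left_mono) auto
        finally show ?thesis .
      qed
      then have "real (K * Suc m) \<le> real (2 * Suc n)"
        by (simp only: of_nat_le_iff)
      then show ?thesis
        using K(1) by (simp add: field_simps)
    qed
    finally have "(\<Sum>k<Suc n. x k) \<le> 2 / real K * real (Suc n) * F m + real (Suc n) * x m"
      using F0[of m] by (simp add: mult_right_mono del: sum.lessThan_Suc)
    then have "F n \<le> (2 / real K * real (Suc n) * F m + real (Suc n) * x m) / real (Suc n)"
      unfolding F_def by (intro divide_right_mono) auto
    also have "\<dots> = 2 / real K * F m + x m"
      using nonzero_mult_div_cancel_left[of "real (Suc n)"]
      by (simp add: add_divide_distrib mult.commute mult.left_commute del: of_nat_Suc)
    finally show ?thesis
      by (simp add: m_def)
  qed
  have "S F \<le> S (\<lambda>n. 2 / real K * F (n div K) + x (n div K))"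
    unfolding S_def using rec p by (intro sum_powr_root_mono) (auto simp: F0 weight_nonneg)
  also have "\<dots> \<le> S (\<lambda>n. 2 / real K * F (n div K)) + S (\<lambda>n. x (n div K))"
    unfolding S_def using p x(2) by (intro Minkowski_sum_powr) (auto simp: F0 weight_nonneg)
  also have "S (\<lambda>n. 2 / real K * F (n div K)) = 2 / real K * S (\<lambda>n. F (n div K))"
    unfolding S_def using p by (intro sum_powr_root_cmult) auto
  also have "\<dots> \<le> 2 / real K * (real K / 4 * S F)"
    by (intro mult_left_mono dilation F_anti F0) auto
  also have "S (\<lambda>n. x (n div K)) \<le> real K / 4 * S x"
    by (intro dilation x)
  \<comment> \<open>The truncation at \<open>T\<close> keeps \<open>S F\<close> a real number, so
    half of it can be subtracted.\<close>
  finally have "S F \<le> S F / 2 + real K / 4 * S x"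
    using K(1) by simp
  then show ?thesis
    by (simp add: S_def)
qed

text \<open>The averages \<open>F f\<close> are subadditive in \<open>f\<close>, and Minkowski's
  inequality passes this on to \<open>N\<close>. They dominate the decreasing rearrangement, and
  Hardy's inequality gives the reverse comparison.\<close>

lemma normable_if_dilation_bound:
  assumes p: "1 \<le> p"
    and K: "0 < K" "\<And>m. W (K * m) powr (1 / p) \<le> real K / 4 * W m powr (1 / p)"
  shows "lorentz_normable \<Omega> p"
proof -
  define F where "F f n = (\<Sum>k<Suc n. rearr f k) / real (Suc n)" for f n
  define N where "N T f = (\<Sum>n<T. F f n powr p * \<Omega> n) powr (1 / p)" for T f
  have F0: "0 \<le> F f n" for f n
    unfolding F_def by (intro divide_nonneg_nonneg sum_nonneg) auto
  show ?thesis
  proof (rule lorentz_normableI[of p 1 "real K / 2" N])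
    fix T and f g :: "nat \<Rightarrow> complex"
    assume f: "bounded (range f)" and g: "bounded (range g)"
    have "F (\<lambda>n. f n + g n) n \<le> F f n + F g n" for n
      unfolding F_def add_divide_distrib[symmetric] sum.distrib[symmetric]
      by (intro divide_right_mono sum_rearr_add f g) simp
    then have "N T (\<lambda>n. f n + g n) \<le> (\<Sum>n<T. (F f n + F g n) powr p * \<Omega> n) powr (1 / p)"
      unfolding N_def using p by (intro sum_powr_root_mono) (auto simp: F0 weight_nonneg)
    also have "\<dots> \<le> N T f + N T g"
      unfolding N_def using p by (intro Minkowski_sum_powr) (auto simp: F0 weight_nonneg)
    finally show "N T (\<lambda>n. f n + g n) \<le> N T f + N T g" .
  next
    fix T c and f :: "nat \<Rightarrow> complex"
    assume f: "bounded (range f)"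
    have "F (\<lambda>n. c * f n) n = cmod c * F f n" for n
      unfolding F_def rearr_cmult[OF f] sum_distrib_left[symmetric] by simp
    then show "N T (\<lambda>n. c * f n) = cmod c * N T f"
      unfolding N_def using p by (simp add: sum_powr_root_cmult)
    have "N T f \<le> real K / 2 * trunc_norm p T f"
      unfolding N_def F_def trunc_norm_def
      by (intro Hardy_inequality_antimono p rearr_antimono f K) simp
    then show "\<exists>T'. N T f \<le> real K / 2 * trunc_norm p T' f"
      by blast
    have "rearr f n \<le> F f n" for n
    proof -
      have "(\<Sum>k<Suc n. rearr f n) \<le> (\<Sum>k<Suc n. rearr f k)"
        using rearr_antimono[OF f] by (intro sum_mono) (auto simp: antimono_def)
      then show ?thesis
        by (simp add: F_def field_simps del: sum.lessThan_Suc)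
    qed
    then have "trunc_norm p T f \<le> 1 * N T f"
      unfolding trunc_norm_def N_def using p by (simp, intro sum_powr_root_mono) (auto simp: weight_nonneg)
    then show "\<exists>T'. trunc_norm p T f \<le> 1 * N T' f"
      by blast
  qed (use p K(1) in auto)
qed

text \<open>The sums \<open>S\<close> and \<open>u\<close> are comparable:
  \<open>u n <= S n <= C * u n\<close>. Passing from \<open>2 ^ L * m\<close> to its double adds at
  least \<open>u m / (2 * C)\<close> to \<open>S\<close>, so \<open>S\<close>, and with it
  \<open>u\<close>, grows at least linearly in \<open>L\<close>.\<close>

lemma dilation_bound_if_sum_bound:
  assumes C: "\<And>n. (\<Sum>k<n. 1 / W (Suc k) powr (1 / p)) \<le> C * (real n / W n powr (1 / p))" and p: "0 < p"
  obtains K where "0 < K" "\<And>m. W (K * m) powr (1 / p) \<le> real K / 4 * W m powr (1 / p)"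
proof -
  define S where "S n = (\<Sum>k<n. 1 / W (Suc k) powr (1 / p))" for n
  define u where "u n = real n / W n powr (1 / p)" for n
  have Su: "S n \<le> C * u n" for n
    using C by (simp add: S_def u_def)
  have Wp: "0 < W n powr (1 / p)" if "0 < n" for n
    using W_pos[OF that] by simp
  have step: "S m + real (n - m) / W n powr (1 / p) \<le> S n" if mn: "m \<le> n" for m n
  proof -
    have "(\<Sum>k=m..<n. 1 / W n powr (1 / p)) \<le> (\<Sum>k=m..<n. 1 / W (Suc k) powr (1 / p))"
      using p Wp by (intro sum_mono divide_left_mono powr_mono2 W_mono) (auto intro!: mult_pos_pos)
    moreover have "S n = S m + (\<Sum>k=m..<n. 1 / W (Suc k) powr (1 / p))"
      using sum.atLeastLessThan_concat[of 0 m n "\<lambda>k. 1 / W (Suc k) powr (1 / p)"] mn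
      by (simp add: S_def atLeast0LessThan)
    ultimately show ?thesis by simp
  qed
  have uS: "u n \<le> S n" for n
    using step[of 0 n] by (simp add: S_def u_def)
  have C0: "0 < C"
  proof -
    have "0 < u 1" using W_pos[of 1] by (simp add: u_def)
    then show ?thesis
      using Su[of 1] uS[of 1] by (smt (verit) mult_nonpos_nonneg)
  qed
  have grow: "real L * u m / (2 * C) \<le> S (2 ^ L * m)" for L m
  proof (induction L)
    case 0
    show ?case by (simp add: S_def sum_nonneg)
  next
    case (Suc L)
    have S0: "0 \<le> u n" for n by (simp add: u_def)
    have "u m \<le> S (2 ^ Suc L * m)"
      using step[of m "2 ^ Suc L * m"] uS[of m]
      by (smt (verit) W_nonneg divide_nonneg_nonneg le_add1 mult.commute mult_le_mono2 nat_mult_1_right of_nat_0_le_iff one_le_numeral one_le_power powr_ge_zero)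
    also have "\<dots> \<le> C * u (2 ^ Suc L * m)"
      by (rule Su)
    finally have "u m / (2 * C) \<le> u (2 ^ Suc L * m) / 2"
      using C0 by (simp add: field_simps)
    also have "u (2 ^ Suc L * m) / 2
      = real (2 ^ Suc L * m - 2 ^ L * m) / W (2 ^ Suc L * m) powr (1 / p)"
      by (simp add: u_def)
    finally have "S (2 ^ L * m) + u m / (2 * C) \<le> S (2 ^ Suc L * m)"
      using step[of "2 ^ L * m" "2 ^ Suc L * m"] by simp
    moreover have "real (Suc L) * u m / (2 * C) = real L * u m / (2 * C) + u m / (2 * C)"
      by (simp add: distrib_right add_divide_distrib)
    ultimately show ?case
      using Suc by linarith
  qed
  \<comment> \<open>Growth gives \<open>u (2 ^ L * m) >= L / (2 * C\<^sup>2) * u m\<close>; this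
    choice makes the factor at least 4.\<close>
  obtain L :: nat where L: "8 * C\<^sup>2 \<le> real L"
    using real_arch_simple by blast
  show ?thesis
  proof (rule that[of "2 ^ L"])
    fix m
    show "W (2 ^ L * m) powr (1 / p) \<le> real (2 ^ L) / 4 * W m powr (1 / p)"
    proof (cases "m = 0")
      case True
      then show ?thesis by (simp add: W_def)
    next
      case False
      have "8 * C\<^sup>2 * u m / (2 * C) \<le> real L * u m / (2 * C)"
        using L C0 by (intro divide_right_mono mult_right_mono) (auto simp: u_def)
      also have "\<dots> \<le> C * u (2 ^ L * m)"
        using grow Su order_trans by blast
      finally have "4 * u m \<le> u (2 ^ L * m)"
        using C0 by (simp add: power2_eq_square)
      then show ?thesis
        using Wp[of m] Wp[of "2 ^ L * m"] False by (simp add: u_def field_simps)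
    qed
  qed simp
qed

subsection \<open>Weight conditions necessary for normability\<close>

lemma ex_powr_ge:
  assumes "0 < e"
  shows "\<exists>n. B \<le> real (Suc n) powr e"
proof -
  obtain n :: nat where n: "max B 0 powr (1 / e) \<le> real n"
    using real_arch_simple by blast
  then have "(max B 0 powr (1 / e)) powr e \<le> real (Suc n) powr e"
    using assms by (intro powr_mono2) auto
  then show ?thesis
    using assms by (auto simp: powr_powr)
qed

lemma lorentz_real_step:
  fixes n :: nat
  assumes p: "0 < p" and s: "0 \<le> s"
  defines "f \<equiv> \<lambda>k. complex_of_real (if k < n then s else 0)"
  shows "f \<in> lorentz_space \<Omega> p" "lorentz_real p f = s * W n powr (1 / p)"
proof -
  let ?x = "\<lambda>k. if k < n then s else 0"
  have x: "antimono ?x" "\<And>k. 0 \<le> ?x k"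
    using s by (auto simp: antimono_def)
  note f = rearr_of_antimono[OF x, folded f_def]
  have supp: "?x k = 0" if "n \<le> k" for k
    using that by simp
  show "f \<in> lorentz_space \<Omega> p"
    by (rule finite_support_in_lorentz_space[OF p f supp])
  have "lorentz_real p f = (\<Sum>k<n. ?x k powr p * \<Omega> k) powr (1 / p)"
    by (rule lorentz_real_finite_support[OF p f supp])
  also have "(\<Sum>k<n. ?x k powr p * \<Omega> k) = s powr p * W n"
    by (simp add: W_def sum_distrib_left)
  finally show "lorentz_real p f = s * W n powr (1 / p)"
    using p s by (simp add: powr_mult powr_powr)
qed

section \<open>Averaging over cyclic shifts\<close>

text \<open>Replacing a decreasing \<open>x\<close> by its mean on \<open>{..<N}\<close> enlarges
  the Lorentz functional by at most the factor \<open>C\<close>. Multiplying through by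
  \<open>N\<close> avoids a division when \<open>N = 0\<close>.\<close>

definition average_bound :: "real \<Rightarrow> real \<Rightarrow> bool" where
  "average_bound p C \<longleftrightarrow> (\<forall>x N. antimono x \<longrightarrow> (\<forall>k. 0 \<le> x k) \<longrightarrow> (\<forall>k\<ge>N. x k = 0) \<longrightarrow>
    (\<Sum>k<N. x k) * W N powr (1 / p) \<le> C * real N * (\<Sum>k<N. x k powr p * \<Omega> k) powr (1 / p))"

lemma average_boundD:
  assumes "average_bound p C" "antimono x" "\<And>k. 0 \<le> x k" "\<And>k. N \<le> k \<Longrightarrow> x k = 0"
  shows "(\<Sum>k<N. x k) * W N powr (1 / p)
    \<le> C * real N * (\<Sum>k<N. x k powr p * \<Omega> k) powr (1 / p)"
  using assms unfolding average_bound_def by blast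

text \<open>The sum of the cyclic shifts of \<open>x\<close> on \<open>{..<N}\<close> is constant there, while the shifts all have
  the same rearrangement.\<close>

lemma normable_average_bound:
  assumes p: "0 < p" and n: "lorentz_normable \<Omega> p"
  obtains C where "0 < C" "average_bound p C"
proof -
  obtain C where C: "0 < C"
    "\<And>F (J :: nat). (\<And>j. j < J \<Longrightarrow> F j \<in> lorentz_space \<Omega> p) \<Longrightarrow>
      (\<lambda>n. \<Sum>j<J. F j n) \<in> lorentz_space \<Omega> p \<and>
      lorentz_real p (\<lambda>n. \<Sum>j<J. F j n) \<le> C * (\<Sum>j<J. lorentz_real p (F j))"
    using lorentz_normableD[OF p n] by blast
  have "average_bound p C"
    unfolding average_bound_def
  proof (intro allI impI)
    fix x :: "nat \<Rightarrow> real" and N :: nat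
    assume x: "antimono x" "\<forall>k. 0 \<le> x k" and "\<forall>k\<ge>N. x k = 0"
    then have supp: "\<And>k. N \<le> k \<Longrightarrow> x k = 0" by blast
    define \<sigma> where "\<sigma> i k = (if k < N then (k + i) mod N else k)" for i k
    define f where "f = (\<lambda>k. complex_of_real (x k))"
    note f = rearr_of_antimono[OF x(1) spec[OF x(2)], folded f_def]
    have \<sigma>_lt: "\<sigma> i k < N \<longleftrightarrow> k < N" for i k
      by (auto simp: \<sigma>_def)
    have \<sigma>_inv: "\<sigma> i (\<sigma> (N - i) k) = k" "\<sigma> (N - i) (\<sigma> i k) = k" if "i < N" for i k
    proof -
      have "((k + (N - i)) mod N + i) mod N = k" "((k + i) mod N + (N - i)) mod N = k" if "k < N"
        unfolding mod_add_left_eq using \<open>i < N\<close> that by simp_all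
      then show "\<sigma> i (\<sigma> (N - i) k) = k" "\<sigma> (N - i) (\<sigma> i k) = k"
        by (auto simp: \<sigma>_def)
    qed
    have \<sigma>: "bij (\<sigma> i)" if "i < N" for i
      using \<sigma>_inv[OF that] by (intro o_bij[of "\<sigma> (N - i)"]) (auto simp: fun_eq_iff)
    have F: "f \<circ> \<sigma> i \<in> lorentz_space \<Omega> p"
      "lorentz_real p (f \<circ> \<sigma> i) = (\<Sum>k<N. x k powr p * \<Omega> k) powr (1 / p)" if "i < N" for i
    proof -
      have b: "bounded (range (f \<circ> \<sigma> i))"
        by (rule bounded_subset[OF f(1)]) auto
      have r: "rearr (f \<circ> \<sigma> i) k = x k" for k
        using rearr_compose_bij[OF f(1) \<sigma>[OF that]] f(2) by simp
      show "f \<circ> \<sigma> i \<in> lorentz_space \<Omega> p"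
        by (rule finite_support_in_lorentz_space[OF p b r supp])
      show "lorentz_real p (f \<circ> \<sigma> i) = (\<Sum>k<N. x k powr p * \<Omega> k) powr (1 / p)"
        by (rule lorentz_real_finite_support[OF p b r supp])
    qed
    have sum: "(\<Sum>i<N. (f \<circ> \<sigma> i) k) = complex_of_real (if k < N then \<Sum>j<N. x j else 0)" for k
    proof (cases "k < N")
      case True
      have "(\<Sum>i<N. x (\<sigma> i k)) = (\<Sum>j<N. x j)"
      \<comment> \<open>For fixed \<open>k\<close> the rotated position runs through all of
        \<open>{..<N}\<close> as the shift \<open>i\<close> varies, since
        \<open>\<sigma> i k\<close> is symmetric in \<open>i\<close> and \<open>k\<close>
        there.\<close>
      proof (rule sum.reindex_bij_witness[of _ "\<lambda>j. \<sigma> (N - k) j" "\<lambda>i. \<sigma> i k"])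
        fix i assume i: "i \<in> {..<N}"
        then have "\<sigma> i k = \<sigma> k i"
          using True by (simp add: \<sigma>_def add.commute)
        then show "\<sigma> (N - k) (\<sigma> i k) = i" "\<sigma> i k \<in> {..<N}"
          using \<sigma>_inv(2)[OF True] True \<sigma>_lt i by auto
      next
        fix j assume j: "j \<in> {..<N}"
        then have "\<sigma> (\<sigma> (N - k) j) k = \<sigma> k (\<sigma> (N - k) j)"
          using True \<sigma>_lt[of "N - k" j] by (simp add: \<sigma>_def[of _ k] \<sigma>_def[of k] add.commute)
        then show "\<sigma> (\<sigma> (N - k) j) k = j" "\<sigma> (N - k) j \<in> {..<N}"
          using \<sigma>_inv(1)[OF True] j \<sigma>_lt by auto
      qed simp
      then show ?thesis
        using True by (simp add: f_def flip: of_real_sum)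
    next
      case False
      then show ?thesis
        by (simp add: \<sigma>_def f_def supp)
    qed
    have "(\<Sum>j<N. x j) * W N powr (1 / p)
      = lorentz_real p (\<lambda>k. complex_of_real (if k < N then \<Sum>j<N. x j else 0))"
      using x(2) by (intro lorentz_real_step(2)[symmetric] p sum_nonneg) auto
    also have "\<dots> = lorentz_real p (\<lambda>k. \<Sum>i<N. (f \<circ> \<sigma> i) k)"
      by (simp only: sum)
    also have "\<dots> \<le> C * (\<Sum>i<N. lorentz_real p (f \<circ> \<sigma> i))"
      using C(2)[of N "\<lambda>i. f \<circ> \<sigma> i"] F(1) by blast
    also have "(\<Sum>i<N. lorentz_real p (f \<circ> \<sigma> i))
      = (\<Sum>i<N. (\<Sum>k<N. x k powr p * \<Omega> k) powr (1 / p))"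
      by (intro sum.cong F(2)) auto
    finally show "(\<Sum>k<N. x k) * W N powr (1 / p)
        \<le> C * real N * (\<Sum>k<N. x k powr p * \<Omega> k) powr (1 / p)"
      by simp
  qed
  then show ?thesis
    using that C(1) by blast
qed

section \<open>Exponents at least 1: indicators and dyadic test sequences\<close>

text \<open>Tested on the indicator of \<open>{..<m}\<close>. For positive \<open>m\<close> it says
  that \<open>n / W n powr (1 / p)\<close> increases up to the factor \<open>C\<close>.\<close>

lemma average_bound_step:
  assumes p: "0 < p" and C: "average_bound p C" and mn: "m \<le> n"
  shows "real m * W n powr (1 / p) \<le> C * real n * W m powr (1 / p)"
proof -
  let ?x = "\<lambda>k. if k < m then 1 else 0 :: real"
  have "{..<n} \<inter> {k. k < m} = {..<m}"
    using mn by auto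
  then have "(\<Sum>k<n. ?x k) = real m" "(\<Sum>k<n. ?x k powr p * \<Omega> k) = W m"
    by (simp_all add: sum.If_cases W_def if_distrib[of "\<lambda>t. t powr p * _"] cong: if_cong)
  moreover have "(\<Sum>k<n. ?x k) * W n powr (1 / p)
      \<le> C * real n * (\<Sum>k<n. ?x k powr p * \<Omega> k) powr (1 / p)"
    using mn by (intro average_boundD[OF C]) (auto simp: antimono_def)
  ultimately show ?thesis by simp
qed

lemma quasi_decreasing_if_normable_1:
  assumes "lorentz_normable \<Omega> 1"
  obtains C where "\<And>m n. 0 < m \<Longrightarrow> m \<le> n \<Longrightarrow> W n / real n \<le> C * (W m / real m)"
proof -
  obtain C where C: "average_bound 1 C"
    using normable_average_bound[OF zero_less_one assms] by blast
  show ?thesis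
  proof (rule that[of C])
    fix m n :: nat assume "0 < m" "m \<le> n"
    then show "W n / real n \<le> C * (W m / real m)"
      using average_bound_step[OF zero_less_one C, of m n] by (simp add: field_simps)
  qed
qed

text \<open>The test sequence \<open>\<Sum>j\<le>L. 2^(-j)\<close> times the indicator of \<open>{..<2^j * m}\<close> has sum
  \<open>(L + 1) * m\<close>, but its Lorentz functional only grows like \<open>(L + 1) powr (1 / p)\<close>.\<close>

lemma average_bound_dyadic:
  assumes p: "0 < p" and C0: "0 < C"
    and C: "average_bound p C"
    and m: "0 < m"
  shows "real (Suc L) * real m * W (2 ^ L * m) powr (1 / p)
    \<le> 2 * C\<^sup>2 * real (2 ^ L * m) * (real (Suc L) powr (1 / p) * W m powr (1 / p))"
proof -
  define N where "N = 2 ^ L * m"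
  define y where "y j k = (if k < 2 ^ j * m then (1 / 2) ^ j else 0 :: real)" for j k :: nat
  define x where "x k = (\<Sum>j<Suc L. y j k)" for k
  have N: "2 ^ j * m \<le> N" if "j < Suc L" for j
    using that by (simp add: N_def power_increasing)
  have y0: "0 \<le> y j k" for j k
    by (simp add: y_def)
  have x_anti: "antimono x"
    unfolding x_def by (intro antimonoI sum_mono) (auto simp: y_def)
  have x0: "0 \<le> x k" for k
    unfolding x_def by (intro sum_nonneg y0)
  have x_supp: "x k = 0" if "N \<le> k" for k
    unfolding x_def using that N by (intro sum.neutral) (force simp: y_def)
  have indicator: "{..<N} \<inter> {k. k < 2 ^ j * m} = {..<2 ^ j * m}" if "j < Suc L" for j
    using N[OF that] by auto
  have sum_x: "(\<Sum>k<N. x k) = real (Suc L) * real m"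
  proof -
    have "(\<Sum>k<N. x k) = (\<Sum>j<Suc L. \<Sum>k<N. y j k)"
      unfolding x_def by (rule sum.swap)
    also have "\<dots> = (\<Sum>j<Suc L. real m)"
    proof (intro sum.cong refl)
      fix j assume "j \<in> {..<Suc L}"
      then show "(\<Sum>k<N. y j k) = real m"
        by (simp add: y_def sum.If_cases indicator power_one_over)
    qed
    finally show ?thesis by simp
  qed
  \<comment> \<open>At \<open>k\<close> the nonzero terms form a geometric progression whose sum is
    at most twice its first term. Hence the power of the sum is controlled by the power of a single
    term.\<close>
  have x_le: "x k powr p \<le> (\<Sum>j<Suc L. (2 * y j k) powr p)" for k
  proof (cases "\<exists>j<Suc L. k < 2 ^ j * m")
    case False
    then have "x k = 0"
      by (auto simp: x_def y_def)
    then show ?thesis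
      by (simp add: sum_nonneg)
  next
    case True
    define i where "i = (LEAST j. k < 2 ^ j * m)"
    have i: "k < 2 ^ i * m" "i < Suc L"
      using True unfolding i_def by (auto intro: LeastI Least_le[THEN le_less_trans])
    have low: "y j k = 0" if "j < i" for j
      using not_less_Least[of j "\<lambda>j. k < 2 ^ j * m"] that by (simp add: y_def i_def)
    have geo: "(\<Sum>j=i..<n. (1 / 2) ^ j) \<le> 2 * (1 / 2 :: real) ^ i - (1 / 2) ^ n * 2" if "i \<le> n" for n
      using that by (induction n rule: dec_induct) auto
    have "x k = (\<Sum>j=i..<Suc L. y j k)"
      unfolding x_def by (rule sum.mono_neutral_right) (use low in force)+
    also have "\<dots> \<le> (\<Sum>j=i..<Suc L. (1 / 2) ^ j)"
      by (intro sum_mono) (auto simp: y_def)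
    also have "\<dots> \<le> 2 * (1 / 2) ^ i"
      using i by (intro order_trans[OF geo]) auto
    also have "\<dots> = 2 * y i k"
      using i by (simp add: y_def)
    finally have "x k powr p \<le> (2 * y i k) powr p"
      using p x0 by (intro powr_mono2) auto
    also have "\<dots> \<le> (\<Sum>j<Suc L. (2 * y j k) powr p)"
      using i by (intro member_le_sum) auto
    finally show ?thesis .
  qed
  \<comment> \<open>Each of the \<open>L + 1\<close> dyadic layers thus contributes at most a fixed
    multiple of \<open>W m\<close>.\<close>
  have W_dyadic: "((1 / 2) ^ j) powr p * W (2 ^ j * m) \<le> C powr p * W m" for j
  proof -
    have "real m * W (2 ^ j * m) powr (1 / p) \<le> C * real (2 ^ j * m) * W m powr (1 / p)"
      by (intro average_bound_step p C) auto
    then have "(1 / 2) ^ j * W (2 ^ j * m) powr (1 / p) \<le> C * W m powr (1 / p)"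
      using m by (simp add: field_simps power_one_over)
    then have "((1 / 2) ^ j * W (2 ^ j * m) powr (1 / p)) powr p \<le> (C * W m powr (1 / p)) powr p"
      using p by (intro powr_mono2) auto
    then show ?thesis
      unfolding powr_mult using p by (simp add: powr_powr)
  qed
  have "(\<Sum>k<N. x k powr p * \<Omega> k) \<le> (\<Sum>k<N. (\<Sum>j<Suc L. (2 * y j k) powr p) * \<Omega> k)"
    by (intro sum_mono mult_right_mono x_le weight_nonneg)
  also have "\<dots> = (\<Sum>j<Suc L. \<Sum>k<N. (2 * y j k) powr p * \<Omega> k)"
    unfolding sum_distrib_right by (rule sum.swap)
  also have "\<dots> \<le> (\<Sum>j<Suc L. 2 powr p * (C powr p * W m))"
  proof (intro sum_mono)
    fix j assume "j \<in> {..<Suc L}"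
    then have j: "j < Suc L" by simp
    have "(\<Sum>k<N. (2 * y j k) powr p * \<Omega> k)
        = (\<Sum>k<N. if k < 2 ^ j * m then 2 powr p * ((1 / 2) ^ j) powr p * \<Omega> k else 0)"
      by (intro sum.cong) (auto simp: y_def powr_mult)
    also have "\<dots> = 2 powr p * (((1 / 2) ^ j) powr p * W (2 ^ j * m))"
      by (simp add: sum.If_cases indicator[OF j] W_def sum_distrib_left mult.assoc)
    also have "\<dots> \<le> 2 powr p * (C powr p * W m)"
      by (intro mult_left_mono W_dyadic) auto
    finally show "(\<Sum>k<N. (2 * y j k) powr p * \<Omega> k) \<le> 2 powr p * (C powr p * W m)" .
  qed
  also have "\<dots> = (2 * C) powr p * (real (Suc L) * W m)"
    by (simp add: powr_mult)
  finally have "(\<Sum>k<N. x k powr p * \<Omega> k) powr (1 / p)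
    \<le> ((2 * C) powr p * (real (Suc L) * W m)) powr (1 / p)"
    using p by (intro powr_mono2 sum_nonneg) (auto simp: weight_nonneg)
  also have "\<dots> = 2 * C * (real (Suc L) powr (1 / p) * W m powr (1 / p))"
    unfolding powr_mult[of _ "real (Suc L) * W m"] powr_mult[of "real (Suc L)"]
    using p C0 by (simp add: powr_powr)
  finally have "C * real N * (\<Sum>k<N. x k powr p * \<Omega> k) powr (1 / p)
    \<le> C * real N * (2 * C * (real (Suc L) powr (1 / p) * W m powr (1 / p)))"
    using C0 by (intro mult_left_mono) auto
  then show ?thesis
    using average_boundD[OF C x_anti x0, of N, OF x_supp] unfolding sum_x
    by (simp add: N_def power2_eq_square mult_ac)
qed

text \<open>Strong induction splits the sum at \<open>m = n div K\<close>. The part below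
  \<open>m\<close> is at most \<open>2 * C * K * u m\<close>, half of the target because
  \<open>u m <= u n / 2\<close>; the part from \<open>m\<close> on is at most the other half,
  \<open>C * K * u n\<close>.\<close>

lemma sum_bound_if_normable:
  assumes p: "1 < p" and n: "lorentz_normable \<Omega> p"
  obtains C where "\<And>n. (\<Sum>k<n. 1 / W (Suc k) powr (1 / p)) \<le> C * (real n / W n powr (1 / p))"
proof -
  have p0: "0 < p" using p by simp
  obtain C where C0: "0 < C" and C: "average_bound p C"
    using normable_average_bound[OF p0 n] by blast
  define u where "u n = real n / W n powr (1 / p)" for n
  have Wp: "0 < W n powr (1 / p)" if "0 < n" for n
    using W_pos[OF that] by simp
  have u0: "0 \<le> u n" for n
    by (simp add: u_def)
  have u_mono: "u m \<le> C * u n" if "m \<le> n" for m n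
  proof (cases "m = 0")
    case True
    then show ?thesis using u0[of n] C0 by (simp add: u_def)
  next
    case False
    then show ?thesis
      using average_bound_step[OF p0 C that] Wp[of m] Wp[of n] that
      by (simp add: u_def field_simps)
  qed
  \<comment> \<open>Here \<open>p > 1\<close> makes the exponent positive. The constant is the
    product of \<open>2 * C\<^sup>2\<close> from \<open>average_bound_dyadic\<close> and the desired
    growth factor \<open>2 * C\<close>.\<close>
  obtain L where L: "4 * C ^ 3 \<le> real (Suc L) powr (1 - 1 / p)"
    using ex_powr_ge[of "1 - 1 / p" "4 * C ^ 3"] p by auto
  define K :: nat where "K = 2 ^ L"
  have K0: "0 < K" by (simp add: K_def)
  have u_dyadic: "2 * C * u m \<le> u (K * m)" if m: "0 < m" for m
  proof -
    have "real (Suc L) powr (1 - 1 / p) * u m \<le> 2 * C\<^sup>2 * u (K * m)"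
    proof -
      have "real (Suc L) powr (1 - 1 / p) * real (Suc L) powr (1 / p) = real (Suc L)"
        by (simp flip: powr_add)
      then have "real (Suc L) powr (1 / p) * (real (Suc L) powr (1 - 1 / p) * real m * W (K * m) powr (1 / p))
          = real (Suc L) * real m * W (K * m) powr (1 / p)"
        by (simp add: mult_ac)
      also have "\<dots> \<le> 2 * C\<^sup>2 * real (K * m) * (real (Suc L) powr (1 / p) * W m powr (1 / p))"
        unfolding K_def by (rule average_bound_dyadic[OF p0 C0 C m])
      also have "\<dots> = real (Suc L) powr (1 / p) * (2 * C\<^sup>2 * real (K * m) * W m powr (1 / p))"
        by (simp add: mult_ac)
      finally have "real (Suc L) powr (1 - 1 / p) * real m * W (K * m) powr (1 / p)
          \<le> 2 * C\<^sup>2 * real (K * m) * W m powr (1 / p)"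
        by (subst (asm) mult_le_cancel_left_pos) auto
      then show ?thesis
        using Wp[of m] Wp[of "K * m"] m K0 by (simp add: u_def field_simps)
    qed
    moreover have "4 * C ^ 3 * u m \<le> real (Suc L) powr (1 - 1 / p) * u m"
      using L u0 by (intro mult_right_mono) auto
    ultimately have "2 * C\<^sup>2 * (2 * C * u m) \<le> 2 * C\<^sup>2 * u (K * m)"
      by (simp add: power2_eq_square power3_eq_cube mult_ac)
    then show ?thesis
      using C0 by (subst (asm) mult_le_cancel_left_pos) auto
  qed
  \<comment> \<open>One factor \<open>C\<close> of the growth is spent on passing from
    \<open>K * m\<close> to a larger \<open>n\<close>.\<close>
  have u_half: "u m \<le> u n / 2" if "0 < m" "K * m \<le> n" for m n
  proof -
    have "2 * C * u m \<le> C * u n"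
      using u_dyadic[OF that(1)] u_mono[OF that(2)] by linarith
    then show ?thesis
      using C0 by simp
  qed
  \<comment> \<open>There are fewer than \<open>K * Suc m\<close> terms, each at most
    \<open>C * u n / Suc m\<close>.\<close>
  have sum_le: "(\<Sum>k=m..<n. 1 / W (Suc k) powr (1 / p)) \<le> C * real K * u n" if "n < K * Suc m" for m n
  proof -
    have "1 / W (Suc k) powr (1 / p) \<le> C * u n / real (Suc m)" if k: "k \<in> {m..<n}" for k
    proof -
      have "1 / W (Suc k) powr (1 / p) = u (Suc k) / real (Suc k)"
        by (simp add: u_def)
      also have "\<dots> \<le> C * u n / real (Suc m)"
        using k C0 u0 by (intro frac_le u_mono mult_nonneg_nonneg) auto
      finally show ?thesis .
    qed
    then have "(\<Sum>k=m..<n. 1 / W (Suc k) powr (1 / p)) \<le> (\<Sum>k=m..<n. C * u n / real (Suc m))"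
      by (intro sum_mono)
    also have "\<dots> = C * u n * (real (n - m) / real (Suc m))"
      by simp
    also have "\<dots> \<le> C * u n * real K"
    proof (intro mult_left_mono mult_nonneg_nonneg u0)
      have "real (n - m) \<le> real (K * Suc m)"
        using that by linarith
      then show "real (n - m) / real (Suc m) \<le> real K"
        by (simp add: field_simps)
    qed (use C0 in auto)
    finally show ?thesis by (simp add: mult_ac)
  qed
  show ?thesis
  proof (rule that[of "2 * C * real K"])
    fix n
    have "(\<Sum>k<n. 1 / W (Suc k) powr (1 / p)) \<le> 2 * C * real K * u n"
    proof (induction n rule: less_induct)
      case (less n)
      define m where "m = n div K"
      have n_lt: "n < K * Suc m"
        using K0 unfolding m_def by (metis dividend_less_times_div mult_Suc_right)
      show ?case
      proof (cases "m = 0 \<or> m = n")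
        case True
        show ?thesis
        proof (cases "m = 0")
          case True
          have "0 \<le> C * real K * u n"
            using C0 u0[of n] by simp
          then show ?thesis
            using sum_le[OF n_lt] True by (simp add: atLeast0LessThan)
        next
          case False
          \<comment> \<open>This would force \<open>K = 1\<close>, which contradicts
            \<open>u_half\<close> at \<open>m = n\<close>.\<close>
          then have "m = n" "0 < n"
            using True by auto
          moreover have "K * m \<le> n"
            by (simp add: m_def)
          ultimately have "u n \<le> u n / 2"
            using u_half[of n n] by simp
          moreover have "0 < u n"
            using Wp[OF \<open>0 < n\<close>] \<open>0 < n\<close> by (simp add: u_def)
          ultimately show ?thesis by simp
        qed
      next
        case False
        moreover have "m \<le> n"
          by (simp add: m_def)
        ultimately have m: "0 < m" "m < n"
          by linarith+
        have Km: "K * m \<le> n"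
          by (simp add: m_def)
        have "(\<Sum>k<n. 1 / W (Suc k) powr (1 / p))
          = (\<Sum>k<m. 1 / W (Suc k) powr (1 / p)) + (\<Sum>k=m..<n. 1 / W (Suc k) powr (1 / p))"
          using sum.atLeastLessThan_concat[of 0 m n "\<lambda>k. 1 / W (Suc k) powr (1 / p)"] m
          by (simp add: atLeast0LessThan)
        also have "\<dots> \<le> 2 * C * real K * u m + C * real K * u n"
          by (intro add_mono less.IH m sum_le n_lt)
        also have "2 * C * real K * u m \<le> 2 * C * real K * (u n / 2)"
          using C0 by (intro mult_left_mono u_half m Km) auto
        finally show ?thesis by simp
      qed
    qed
    then show "(\<Sum>k<n. 1 / W (Suc k) powr (1 / p)) \<le> 2 * C * real K * (real n / W n powr (1 / p))"
      by (simp add: u_def)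
  qed
qed

section \<open>Exponents below 1: lacunary test sequences\<close>

text \<open>If \<open>W\<close> is unbounded, choose points \<open>N j\<close> along which \<open>W\<close> at least doubles. Then the sum of
  the normalized indicators of \<open>{..<N j}\<close>, \<open>j < J\<close>, has Lorentz functional at least
  \<open>(J / 2) powr (1 / p)\<close>, which is not \<open>O(J)\<close> for \<open>p < 1\<close>.\<close>

lemma summable_if_normable:
  assumes p: "0 < p" "p < 1" and n: "lorentz_normable \<Omega> p"
  shows "summable \<Omega>"
proof (rule ccontr)
  assume not: "\<not> summable \<Omega>"
  have unbounded: "\<exists>n. B < W n" for B
  proof (rule ccontr)
    assume "\<not> (\<exists>n. B < W n)"
    then have "W n \<le> B" for n by (simp add: not_less)
    then have "summable \<Omega>"
      by (intro bounded_imp_summable[of _ B])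
        (auto simp: weight_nonneg W_def lessThan_Suc_atMost[symmetric] simp del: sum.lessThan_Suc)
    then show False using not by simp
  qed
  have "\<exists>N. \<forall>j. 0 < N j \<and> (N j < N (Suc j) \<and> 2 * W (N j) \<le> W (N (Suc j)))"
  proof (rule dependent_nat_choice)
    show "\<exists>n::nat. 0 < n" by blast
  next
    fix m j :: nat assume m: "0 < m"
    obtain n where n: "2 * W m < W n"
      using unbounded by blast
    then have "\<not> W n \<le> W m"
      using W_pos[OF m] by simp
    then have "m < n"
      using W_mono[of n m] by (meson not_le)
    then show "\<exists>n. 0 < n \<and> (m < n \<and> 2 * W m \<le> W n)"
      using n by (intro exI[of _ n]) auto
  qed
  then obtain N where N: "\<And>j. 0 < N j" "\<And>j. N j < N (Suc j)" "\<And>j. 2 * W (N j) \<le> W (N (Suc j))"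
    by blast
  have N_mono: "strict_mono N"
    using N(2) by (simp add: strict_mono_Suc_iff)
  obtain C where C: "0 < C"
    "\<And>F (J :: nat). (\<And>j. j < J \<Longrightarrow> F j \<in> lorentz_space \<Omega> p) \<Longrightarrow>
      (\<lambda>n. \<Sum>j<J. F j n) \<in> lorentz_space \<Omega> p \<and>
      lorentz_real p (\<lambda>n. \<Sum>j<J. F j n) \<le> C * (\<Sum>j<J. lorentz_real p (F j))"
    using lorentz_normableD[OF p(1) n] by blast
  define a where "a j = 1 / W (N j) powr (1 / p)" for j
  have a0: "0 \<le> a j" for j by (simp add: a_def)
  have main: "real J / 2 \<le> (C * real (Suc J)) powr p" for J
  proof -
    define F where "F j = (\<lambda>k. complex_of_real (if k < N j then a j else 0))" for j
    define x where "x k = (\<Sum>j<Suc J. if k < N j then a j else 0)" for k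
    define f where "f = (\<lambda>k. \<Sum>j<Suc J. F j k)"
    have F: "F j \<in> lorentz_space \<Omega> p" "lorentz_real p (F j) = 1" for j
      unfolding F_def using lorentz_real_step[OF p(1) a0, of "N j" j] W_pos[OF N(1), of j]
      by (auto simp: a_def)
    have f: "f \<in> lorentz_space \<Omega> p" "lorentz_real p f \<le> C * real (Suc J)"
      using C(2)[of "Suc J" F] F unfolding f_def by simp_all
    have x: "antimono x" "\<And>k. 0 \<le> x k"
      unfolding x_def using a0 less_le_trans
      by (auto intro!: antimonoI sum_mono sum_nonneg simp del: sum.lessThan_Suc)
    have f_x: "f = (\<lambda>k. complex_of_real (x k))"
      by (auto simp: f_def F_def x_def)
    have a_le_x: "a j \<le> x k" if "j \<le> J" "k < N j" for j k
    proof -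
      have "(if k < N j then a j else 0) \<le> x k"
        unfolding x_def using that a0 by (intro member_le_sum) auto
      then show ?thesis using that by simp
    qed
    \<comment> \<open>By doubling, the weight between \<open>N i\<close> and
      \<open>N (Suc i)\<close> is at least half of \<open>W (N (Suc i))\<close>, and
      \<open>x\<close> is at least \<open>a (Suc i)\<close> there; each such block contributes at
      least \<open>1 / 2\<close>.\<close>
    have lower: "real i / 2 \<le> (\<Sum>k<N i. x k powr p * \<Omega> k)" if "i \<le> J" for i
      using that
    proof (induction i)
      case 0
      show ?case by (simp add: sum_nonneg weight_nonneg)
    next
      case (Suc i)
      have "a (Suc i) powr p = 1 / W (N (Suc i))"
        using p W_nonneg by (simp add: a_def powr_divide powr_powr)
      moreover have "W (N (Suc i)) = W (N i) + (\<Sum>k=N i..<N (Suc i). \<Omega> k)"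
        using sum.atLeastLessThan_concat[of 0 "N i" "N (Suc i)" \<Omega>] N(2)[of i]
        by (simp add: W_def atLeast0LessThan)
      ultimately have "1 / 2 \<le> a (Suc i) powr p * (\<Sum>k=N i..<N (Suc i). \<Omega> k)"
        using N(3)[of i] W_pos[OF N(1), of "Suc i"] by (simp add: pos_le_divide_eq)
      also have "\<dots> = (\<Sum>k=N i..<N (Suc i). a (Suc i) powr p * \<Omega> k)"
        by (rule sum_distrib_left)
      also have "\<dots> \<le> (\<Sum>k=N i..<N (Suc i). x k powr p * \<Omega> k)"
        using Suc.prems p a_le_x a0 by (intro sum_mono mult_right_mono powr_mono2 weight_nonneg) auto
      finally show ?case
        using Suc sum.atLeastLessThan_concat[of 0 "N i" "N (Suc i)" "\<lambda>k. x k powr p * \<Omega> k"] N(2)[of i]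
        by (simp add: atLeast0LessThan)
    qed
    have "(\<Sum>k<N J. x k powr p * \<Omega> k) powr (1 / p) = trunc_norm p (N J) f"
      unfolding trunc_norm_def f_x rearr_of_antimono(2)[OF x] ..
    also have "\<dots> \<le> lorentz_real p f"
      by (rule trunc_norm_le_lorentz_real[OF p(1) f(1)])
    finally have "((\<Sum>k<N J. x k powr p * \<Omega> k) powr (1 / p)) powr p \<le> (C * real (Suc J)) powr p"
      using f(2) p by (intro powr_mono2) auto
    then have "(\<Sum>k<N J. x k powr p * \<Omega> k) \<le> (C * real (Suc J)) powr p"
      using p by (simp add: powr_powr sum_nonneg weight_nonneg)
    then show ?thesis
      using lower[of J] by simp
  qed
  \<comment> \<open>By \<open>main\<close> and \<open>Suc (Suc J) <= 2 * Suc J\<close>, the number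
    \<open>Suc J\<close> is at most \<open>Suc J powr p * B\<close>. Since \<open>1 - p > 0\<close>,
    a large \<open>J\<close> contradicts this.\<close>
  define B where "B = 2 * (2 * C) powr p"
  obtain J where J: "B + 1 \<le> real (Suc J) powr (1 - p)"
    using ex_powr_ge[of "1 - p" "B + 1"] p by auto
  have "real (Suc J) powr p * real (Suc J) powr (1 - p) = real (Suc J)"
    by (simp flip: powr_add)
  also have "\<dots> \<le> 2 * (C * real (Suc (Suc J))) powr p"
    using main[of "Suc J"] by simp
  also have "\<dots> \<le> 2 * (2 * C * real (Suc J)) powr p"
    using p C(1) by (intro mult_left_mono powr_mono2) auto
  also have "\<dots> = real (Suc J) powr p * B"
    by (simp add: B_def powr_mult)
  finally have "real (Suc J) powr (1 - p) \<le> B"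
    by (subst (asm) mult_le_cancel_left_pos) auto
  then show False
    using J by simp
qed

section \<open>Translation between \<open>partial_weight\<close> and \<open>W\<close>\<close>

lemma quasi_decreasing_iff:
  "(\<exists>C. \<forall>m n. 0 < m \<and> m < n \<longrightarrow>
      partial_weight \<Omega> n / real (n + 1) \<le> C * (partial_weight \<Omega> m / real (m + 1)))
    \<longleftrightarrow> (\<exists>K. \<forall>m n. 0 < m \<longrightarrow> m \<le> n \<longrightarrow> W n / real n \<le> K * (W m / real m))"
proof
  assume "\<exists>C. \<forall>m n. 0 < m \<and> m < n \<longrightarrow>
      partial_weight \<Omega> n / real (n + 1) \<le> C * (partial_weight \<Omega> m / real (m + 1))"
  then obtain C where C: "W (Suc n) / real (Suc n) \<le> C * (W (Suc m) / real (Suc m))"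
    if "0 < m" "m < n" for m n
    unfolding partial_weight_eq_W by auto
  \<comment> \<open>The condition with \<open>0 < m\<close> says nothing about \<open>W 1\<close>.
    \<open>B\<close> bounds \<open>W n / n\<close> for all \<open>n >= 2\<close> by way of
    \<open>W 2\<close>, and dividing by \<open>W 1\<close> covers the missing index; the 1 in
    \<open>K\<close> covers \<open>m = n\<close>.\<close>
  define B where "B = max 1 C * (W 2 / 2)"
  define K where "K = max (max 1 C) (B / W 1)"
  have W1: "0 < W 1" by (simp add: W_pos)
  have "W n / real n \<le> K * (W m / real m)" if mn: "0 < m" "m \<le> n" for m n
  proof -
    have K_ge: "c * (W m / real m) \<le> K * (W m / real m)" if "c \<le> max (max 1 C) (B / W 1)" for c
      using that unfolding K_def by (intro mult_right_mono) auto
    consider "m = n" | "1 < m" "m < n" | "m = 1" "n = 2" | "m = 1" "2 < n"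
      using mn by linarith
    then show ?thesis
    proof cases
      case 1
      then show ?thesis using K_ge[of 1] by simp
    next
      case 2
      then have "W n / real n \<le> C * (W m / real m)"
        using C[of "m - 1" "n - 1"] by simp
      also have "\<dots> \<le> K * (W m / real m)"
        by (intro K_ge) simp
      finally show ?thesis .
    next
      case 3
      have "1 * (W 2 / 2) \<le> B"
        unfolding B_def by (intro mult_right_mono) auto
      then show ?thesis using 3 K_ge[of "B / W 1"] W1 by simp
    next
      case 4
      then have "W n / real n \<le> C * (W 2 / 2)"
        using C[of 1 "n - 1"] by (simp add: numeral_2_eq_2)
      also have "\<dots> \<le> B"
        unfolding B_def by (intro mult_right_mono) auto
      finally show ?thesis using 4 K_ge[of "B / W 1"] W1 by simp
    qed
  qed
  then show "\<exists>K. \<forall>m n. 0 < m \<longrightarrow> m \<le> n \<longrightarrow> W n / real n \<le> K * (W m / real m)"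
    by blast
next
  assume "\<exists>K. \<forall>m n. 0 < m \<longrightarrow> m \<le> n \<longrightarrow> W n / real n \<le> K * (W m / real m)"
  then obtain K where K: "W n / real n \<le> K * (W m / real m)" if "0 < m" "m \<le> n" for m n
    by blast
  then show "\<exists>C. \<forall>m n. 0 < m \<and> m < n \<longrightarrow>
      partial_weight \<Omega> n / real (n + 1) \<le> C * (partial_weight \<Omega> m / real (m + 1))"
    unfolding partial_weight_eq_W Suc_eq_plus1[symmetric] by (intro exI[of _ K] allI impI K) auto
qed

lemma sum_bound_iff:
  "(\<forall>n. (\<Sum>k\<le>n. 1 / partial_weight \<Omega> k powr (1 / p))
      \<le> C * (real (n + 1) / partial_weight \<Omega> n powr (1 / p)))
    \<longleftrightarrow> (\<forall>n. (\<Sum>k<n. 1 / W (Suc k) powr (1 / p)) \<le> C * (real n / W n powr (1 / p)))"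
  (is "?L \<longleftrightarrow> ?R")
proof
  assume L: ?L
  show ?R
  proof
    fix n
    show "(\<Sum>k<n. 1 / W (Suc k) powr (1 / p)) \<le> C * (real n / W n powr (1 / p))"
      \<comment> \<open>For \<open>n = 0\<close> both sides are 0; otherwise the indices differ by
        one.\<close>
      using L[unfolded partial_weight_eq_W Suc_eq_plus1[symmetric], rule_format, of "n - 1"]
      by (cases n) (simp_all add: lessThan_Suc_atMost del: sum.lessThan_Suc)
  qed
next
  assume R: ?R
  show ?L
  proof
    fix n
    show "(\<Sum>k\<le>n. 1 / partial_weight \<Omega> k powr (1 / p))
      \<le> C * (real (n + 1) / partial_weight \<Omega> n powr (1 / p))"
      unfolding partial_weight_eq_W Suc_eq_plus1[symmetric]
      using R[rule_format, of "Suc n"] by (simp add: lessThan_Suc_atMost del: sum.lessThan_Suc)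
  qed
qed

end

theorem theorem2p5p10:
  fixes \<Omega> :: "nat \<Rightarrow> real"
  assumes nonneg: "\<And>n. 0 \<le> \<Omega> n"
    and nonzero: "\<Omega> 0 \<noteq> 0"
  shows
    "(\<forall>p::real. 0 < p \<and> p < 1 \<longrightarrow>
        (lorentz_normable \<Omega> p \<longleftrightarrow> \<Omega> \<in> little_l1) \<and>
        (\<Omega> \<in> little_l1 \<longrightarrow> lorentz_space \<Omega> p = little_linf)) \<and>
     (lorentz_normable \<Omega> 1 \<longleftrightarrow>
        (\<exists>C::real. \<forall>m n. 0 < m \<and> m < n \<longrightarrow>
           partial_weight \<Omega> n / real (n + 1) \<le> C * (partial_weight \<Omega> m / real (m + 1)))) \<and>
     (\<forall>p::real. 1 < p \<longrightarrow>
        (lorentz_normable \<Omega> p \<longleftrightarrow>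
           (\<exists>C::real. \<forall>n.
              (\<Sum>k\<le>n. 1 / partial_weight \<Omega> k powr (1 / p))
                \<le> C * (real (n + 1) / partial_weight \<Omega> n powr (1 / p)))))"
proof -
  interpret lorentz_weight \<Omega>
  proof
    show "0 \<le> \<Omega> n" for n
      by (rule nonneg)
    show "0 < \<Omega> 0"
      using nonneg[of 0] nonzero by linarith
  qed
  have l1: "\<Omega> \<in> little_l1 \<longleftrightarrow> summable \<Omega>"
    by (simp add: little_l1_def nonneg)
  have less_1: "lorentz_normable \<Omega> p \<longleftrightarrow> summable \<Omega>" if "0 < p" "p < 1" for p
    using normable_if_summable[of p] summable_if_normable[of p] that by blast
  have eq_1: "lorentz_normable \<Omega> 1 \<longleftrightarrow>
      (\<exists>K. \<forall>m n. 0 < m \<longrightarrow> m \<le> n \<longrightarrow> W n / real n \<le> K * (W m / real m))"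
    using normable_1_if_quasi_decreasing quasi_decreasing_if_normable_1 by metis
  have greater_1: "lorentz_normable \<Omega> p \<longleftrightarrow>
      (\<exists>C. \<forall>n. (\<Sum>k<n. 1 / W (Suc k) powr (1 / p)) \<le> C * (real n / W n powr (1 / p)))"
    if p: "1 < p" for p
  proof
    assume "lorentz_normable \<Omega> p"
    then obtain C where "\<And>n. (\<Sum>k<n. 1 / W (Suc k) powr (1 / p)) \<le> C * (real n / W n powr (1 / p))"
      using sum_bound_if_normable[OF p] by blast
    then show "\<exists>C. \<forall>n. (\<Sum>k<n. 1 / W (Suc k) powr (1 / p)) \<le> C * (real n / W n powr (1 / p))"
      by blast
  next
    assume "\<exists>C. \<forall>n. (\<Sum>k<n. 1 / W (Suc k) powr (1 / p)) \<le> C * (real n / W n powr (1 / p))"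
    then obtain C where C: "(\<Sum>k<n. 1 / W (Suc k) powr (1 / p)) \<le> C * (real n / W n powr (1 / p))" for n
      by blast
    obtain K where "0 < K" "\<And>m. W (K * m) powr (1 / p) \<le> real K / 4 * W m powr (1 / p)"
      using dilation_bound_if_sum_bound[of p C, OF C] p by auto
    then show "lorentz_normable \<Omega> p"
      using p by (intro normable_if_dilation_bound) auto
  qed
  show ?thesis
    unfolding l1 quasi_decreasing_iff sum_bound_iff
    by (intro conjI allI impI eq_1 greater_1 less_1 lorentz_space_eq_linf) simp_all
qed

end
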